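(* Let $n\ge 1$ and $N=2^n$. Let $E$ be an $n$-qubit unitary ($N\times N$) such that $\left|\mathrm{Tr}(E)\right|\ge N(1-\epsilon^2)$, for some $\epsilon\ge 0$. Let $C_0=\sum_{P\in\mathcal{P}_n}r_PP$ be an $n$-qubit Clifford, expanded in the Pauli basis with $r_P\in\mathbb{C}$. If $\left|\{P\in\mathcal{P}_n:r_P\ne 0\}\right|=M$, then for $P_1\in\mathcal{P}_n$: $$\frac{1-\epsilon^2}{\sqrt{M}}-\sqrt{M}\sqrt{2\epsilon^2-\epsilon^4}\ \le\ \left|\mathrm{Tr}(EC_0P_1)/N\right|\ \le\ \frac{1}{\sqrt{M}}+\sqrt{M}\sqrt{2\epsilon^2-\epsilon^4}\qquad\text{if } r_{P_1}\ne 0,$$ and $$0\ \le\ \left|\mathrm{Tr}(EC_0P_1)/N\right|\ \le\ \sqrt{M}\sqrt{2\epsilon^2-\epsilon^4}\qquad\text{if } r_{P_1}=0.$$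
   Context: $\mathcal{P}_n=\{Q_1\otimes\cdots\otimes Q_n: Q_i\in\{\mathbb{I},X,Y,Z\}\}$ is the set of $n$-qubit Pauli operators (without phases), where $\mathbb{I}$ is the $2\times 2$ identity and $X,Y,Z$ are the $2\times2$ Pauli matrices; it is a basis of the $N\times N$ complex matrices. The $n$-qubit Clifford group $\mathcal{C}_n$ is generated by the Hadamard gate $H=\frac{1}{\sqrt2}\begin{bmatrix}1&1\\1&-1\end{bmatrix}$ and the phase gate $S=\mathrm{diag}(1,i)$ acting on any of the $n$ qubits, and (when $n>1$) the CNOT gate acting on any pair of qubits; an $n$-qubit Clifford is an element of $\mathcal{C}_n$.
   Formalization: The formal theorem assumes 0 ≤ ε ≤ 1 rather than only ε ≥ 0; for 1 < ε ≤ √2 the claim fails (n=1, C_0=I, E=P_1=X), and for ε > √2 the square root of 2ε²−ε⁴ is undefined. *)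

theory Defs
  imports
    "HOL-Algebra.Generated_Groups"
    "Jordan_Normal_Form.Schur_Decomposition"
begin

definition mat_tr :: "'a::comm_monoid_add mat \<Rightarrow> 'a" where
  "mat_tr A = (\<Sum>i<dim_row A. A $$ (i, i))"

definition unitary_mat :: "nat \<Rightarrow> complex mat \<Rightarrow> bool" where
  "unitary_mat N U \<longleftrightarrow> U \<in> carrier_mat N N
     \<and> U * mat_adjoint U = 1\<^sub>m N \<and> mat_adjoint U * U = 1\<^sub>m N"

definition kron :: "'a::semiring_1 mat \<Rightarrow> 'a mat \<Rightarrow> 'a mat" (infixr \<open>\<otimes>\<^sub>K\<close> 70) where
  "A \<otimes>\<^sub>K B = mat (dim_row A * dim_row B) (dim_col A * dim_col B)
     (\<lambda>(i, j). A $$ (i div dim_row B, j div dim_col B) * B $$ (i mod dim_row B, j mod dim_col B))"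

text \<open>\<open>Q\<^sub>1 \<otimes> \<dots> \<otimes> Q\<^sub>n\<close>; the first factor acts on the most significant bit of the index.\<close>

definition kron_list :: "'a::semiring_1 mat list \<Rightarrow> 'a mat" where
  "kron_list Qs = foldr (\<otimes>\<^sub>K) Qs (1\<^sub>m 1)"

abbreviation mat2 :: "complex \<Rightarrow> complex \<Rightarrow> complex \<Rightarrow> complex \<Rightarrow> complex mat" where
  "mat2 a b c d \<equiv> mat_of_rows_list 2 [[a, b], [c, d]]"

definition Pauli_X :: "complex mat" where "Pauli_X = mat2 0 1 1 0"
definition Pauli_Y :: "complex mat" where "Pauli_Y = mat2 0 (- \<i>) \<i> 0"
definition Pauli_Z :: "complex mat" where "Pauli_Z = mat2 1 0 0 (- 1)"

definition pauli_ops :: "nat \<Rightarrow> complex mat set" where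
  "pauli_ops n = {kron_list Qs | Qs. length Qs = n \<and> set Qs \<subseteq> {1\<^sub>m 2, Pauli_X, Pauli_Y, Pauli_Z}}"

definition Hadamard :: "complex mat" where
  "Hadamard = complex_of_real (1 / sqrt 2) \<cdot>\<^sub>m mat2 1 1 1 (- 1)"

definition Phase_S :: "complex mat" where "Phase_S = mat2 1 0 0 \<i>"

definition on_qubit :: "nat \<Rightarrow> nat \<Rightarrow> complex mat \<Rightarrow> complex mat" where
  "on_qubit n k U = kron_list ((replicate n (1\<^sub>m 2))[k := U])"

text \<open>CNOT with control \<open>c\<close> and target \<open>t\<close>, as
  \<open>|0\<rangle>\<langle>0|\<^sub>c \<otimes> I + |1\<rangle>\<langle>1|\<^sub>c \<otimes> X\<^sub>t\<close>.\<close>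

definition CNOT :: "nat \<Rightarrow> nat \<Rightarrow> nat \<Rightarrow> complex mat" where
  "CNOT n c t = kron_list ((replicate n (1\<^sub>m 2))[c := mat2 1 0 0 0])
     + kron_list ((replicate n (1\<^sub>m 2))[c := mat2 0 0 0 1, t := Pauli_X])"

text \<open>For \<open>n = 1\<close> the CNOT part is empty.\<close>

definition clifford_gens :: "nat \<Rightarrow> complex mat set" where
  "clifford_gens n = {on_qubit n k Hadamard | k. k < n} \<union> {on_qubit n k Phase_S | k. k < n}
     \<union> {CNOT n c t | c t. c < n \<and> t < n \<and> c \<noteq> t}"

text \<open>The subgroup of \<open>GL(2\<^sup>n, \<complex>)\<close>, i.e. of the unit group of the matrix ring, generated by the
  gates.\<close>

definition clifford_group :: "nat \<Rightarrow> complex mat set" where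
  "clifford_group n = generate (units_of (ring_mat TYPE(complex) (2 ^ n) ())) (clifford_gens n)"

text \<open>\<open>\<Sum>\<^sub>P r\<^sub>P P\<close> over the \<open>n\<close>-qubit Pauli operators. Matrices of unspecified dimension are not a
  \<open>comm_monoid_add\<close>, so the sum is taken in the module of \<open>2\<^sup>n \<times> 2\<^sup>n\<close> matrices; it is a genuine
  finite sum by \<open>finite_pauli_ops\<close> and \<open>pauli_ops_carrier\<close> below.\<close>

definition pauli_sum :: "nat \<Rightarrow> (complex mat \<Rightarrow> complex) \<Rightarrow> complex mat" where
  "pauli_sum n r = finsum (module_mat TYPE(complex) (2 ^ n) (2 ^ n)) (\<lambda>P. r P \<cdot>\<^sub>m P) (pauli_ops n)"

lemma finite_pauli_ops: "finite (pauli_ops n)"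
proof -
  let ?S = "{Qs. set Qs \<subseteq> {1\<^sub>m 2, Pauli_X, Pauli_Y, Pauli_Z} \<and> length Qs = n}"
  have "pauli_ops n = kron_list ` ?S"
    unfolding pauli_ops_def by auto
  moreover have "finite ?S"
    by (rule finite_lists_length_eq) simp
  ultimately show ?thesis by simp
qed

lemma kron_list_carrier:
  "set Qs \<subseteq> carrier_mat 2 2 \<Longrightarrow> kron_list Qs \<in> carrier_mat (2 ^ length Qs) (2 ^ length Qs)"
  by (induction Qs) (auto simp: kron_list_def kron_def)

lemma pauli_ops_carrier: "pauli_ops n \<subseteq> carrier_mat (2 ^ n) (2 ^ n)"
proof
  fix P assume "P \<in> pauli_ops n"
  then obtain Qs where Qs: "P = kron_list Qs" "length Qs = n"
      "set Qs \<subseteq> {1\<^sub>m 2, Pauli_X, Pauli_Y, Pauli_Z}"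
    unfolding pauli_ops_def by auto
  have "{1\<^sub>m 2, Pauli_X, Pauli_Y, Pauli_Z} \<subseteq> carrier_mat 2 2"
    by (auto simp: Pauli_X_def Pauli_Y_def Pauli_Z_def mat_of_rows_list_def)
  with Qs(3) have "set Qs \<subseteq> carrier_mat 2 2" by (rule subset_trans)
  with Qs kron_list_carrier[of Qs] show "P \<in> carrier_mat (2 ^ n) (2 ^ n)" by simp
qed

end

theory Submission
  imports Defs
begin

text \<open>For a Clifford \<open>C\<close> and a Pauli \<open>P\<close>, the unitary \<open>U = C P\<close> maps every Pauli \<open>Q\<close> to a signed Pauli
  \<open>U\<^sup>* Q U\<close>. Twirling gives \<open>\<Sum>\<^sub>Q Tr (U\<^sup>* Q U Q) = N \<bar>Tr U\<bar>\<^sup>2\<close>, and a Pauli contributes \<open>\<plusminus>N\<close> if it is fixed up to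
  sign and \<open>0\<close> otherwise. A minus sign means that \<open>Q\<close> anticommutes with \<open>U\<close>, so that \<open>Tr U = 0\<close>. Hence
  every nonzero \<open>\<bar>Tr (C P)\<bar>\<^sup>2\<close> equals the number of Paulis that \<open>C\<close> fixes up to sign, which does not
  depend on \<open>P\<close>; by Parseval \<open>\<bar>r\<^sub>P\<bar> = 1 / sqrt M\<close> on the support of \<open>r\<close>. Finally,
  \<open>Tr (E C P\<^sub>1) = \<Sum>\<^sub>P r\<^sub>P Tr (E P P\<^sub>1)\<close>: the term \<open>P = P\<^sub>1\<close> is the main one, and Parseval for \<open>E P\<close>
  bounds every other \<open>\<bar>Tr (E P P\<^sub>1)\<bar>\<^sup>2\<close> by \<open>N\<^sup>2 - \<bar>Tr E\<bar>\<^sup>2\<close>.\<close>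

section \<open>Traces, adjoints and Kronecker products\<close>

text \<open>An index below \<open>a * b\<close> corresponds to exactly one pair of quotient and
  remainder, which is how \<open>kron\<close> encodes its two factors. Cutting the range into
  \<open>a\<close> blocks of length \<open>b\<close> turns the sum into a double sum.\<close>

lemma sum_div_mod:
  fixes f :: "nat \<Rightarrow> nat \<Rightarrow> 'a::comm_monoid_add"
  shows "(\<Sum>k<a * b. f (k div b) (k mod b)) = (\<Sum>i<a. \<Sum>j<b. f i j)"
proof -
  have "(\<Sum>k<a * b. f (k div b) (k mod b)) = (\<Sum>i<a. \<Sum>k\<in>{i * b..<i * b + b}. f (k div b) (k mod b))"
    by (rule sum.nat_group [symmetric])
  also have "\<dots> = (\<Sum>i<a. \<Sum>j<b. f i j)"
  proof (rule sum.cong)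
    fix i
    have "(\<Sum>k\<in>{i * b..<i * b + b}. f (k div b) (k mod b))
        = (\<Sum>j\<in>{0..<b}. f ((j + i * b) div b) ((j + i * b) mod b))"
      using sum.shift_bounds_nat_ivl [of "\<lambda>k. f (k div b) (k mod b)" 0 "i * b" b]
      by (simp add: add.commute)
    also have "\<dots> = (\<Sum>j<b. f i j)"
      by (rule sum.cong) auto
    finally show "(\<Sum>k\<in>{i * b..<i * b + b}. f (k div b) (k mod b)) = (\<Sum>j<b. f i j)" .
  qed simp
  finally show ?thesis .
qed

lemma mat_adjoint_dim [simp]:
  "dim_row (mat_adjoint A) = dim_col A" "dim_col (mat_adjoint A) = dim_row A"
  by (auto simp: mat_adjoint_def)

lemma mat_adjoint_carrier [simp]: "A \<in> carrier_mat m n \<Longrightarrow> mat_adjoint A \<in> carrier_mat n m"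
  by auto

lemma mat_adjoint_index [simp]:
  "i < dim_col A \<Longrightarrow> j < dim_row A \<Longrightarrow> mat_adjoint A $$ (i, j) = cnj (A $$ (j, i))"
  by (auto simp: mat_adjoint_def mat_of_rows_def)

lemma mat_adjoint_mult:
  fixes A B :: "complex mat"
  assumes "dim_col A = dim_row B"
  shows "mat_adjoint (A * B) = mat_adjoint B * mat_adjoint A"
  using assms by (intro eq_matI) (auto simp: scalar_prod_def mult.commute)

lemma mat_adjoint_adjoint [simp]:
  fixes A :: "complex mat"
  shows "mat_adjoint (mat_adjoint A) = A"
  by (intro eq_matI) auto

lemma mat_adjoint_add:
  fixes A :: "complex mat"
  assumes "A \<in> carrier_mat m n" "B \<in> carrier_mat m n"
  shows "mat_adjoint (A + B) = mat_adjoint A + mat_adjoint B"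
  using assms by (intro eq_matI) auto

lemma mat_adjoint_one [simp]: "mat_adjoint (1\<^sub>m n :: complex mat) = 1\<^sub>m n"
  by (intro eq_matI) auto

lemma mat_tr_mult:
  assumes "A \<in> carrier_mat m n" "B \<in> carrier_mat n m"
  shows "mat_tr (A * B) = (\<Sum>i<m. \<Sum>j<n. A $$ (i, j) * B $$ (j, i))"
  using assms by (simp add: mat_tr_def scalar_prod_def lessThan_atLeast0)

lemma mat_tr_comm:
  fixes A :: "'a::comm_semiring_0 mat"
  assumes "A \<in> carrier_mat m n" "B \<in> carrier_mat n m"
  shows "mat_tr (A * B) = mat_tr (B * A)"
  unfolding mat_tr_mult [OF assms] mat_tr_mult [OF assms(2,1)]
  by (subst sum.swap) (simp add: mult.commute)

lemma mat_tr_smult: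
  fixes A :: "'a::semiring_0 mat"
  assumes "A \<in> carrier_mat n n"
  shows "mat_tr (c \<cdot>\<^sub>m A) = c * mat_tr A"
  using assms by (simp add: mat_tr_def sum_distrib_left)

lemma mat_tr_add:
  assumes "A \<in> carrier_mat n n" "B \<in> carrier_mat n n"
  shows "mat_tr (A + B) = mat_tr A + mat_tr B"
  using assms by (simp add: mat_tr_def sum.distrib)

lemma mat_tr_adjoint:
  assumes "A \<in> carrier_mat n n"
  shows "mat_tr (mat_adjoint A) = cnj (mat_tr A)"
  using assms by (simp add: mat_tr_def)

lemma mat_tr_one: "mat_tr (1\<^sub>m n :: 'a::semiring_1 mat) = of_nat n"
  by (simp add: mat_tr_def)

section \<open>Kronecker products of two matrices\<close>

lemma kron_dim [simp]:
  "dim_row (A \<otimes>\<^sub>K B) = dim_row A * dim_row B" "dim_col (A \<otimes>\<^sub>K B) = dim_col A * dim_col B"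
  by (auto simp: kron_def)

lemma kron_index [simp]:
  assumes "i < dim_row A * dim_row B" "j < dim_col A * dim_col B"
  shows "(A \<otimes>\<^sub>K B) $$ (i, j)
    = A $$ (i div dim_row B, j div dim_col B) * B $$ (i mod dim_row B, j mod dim_col B)"
  using assms by (simp add: kron_def)

lemma div_mod_less_mult:
  fixes i a b :: nat
  assumes "i < a * b"
  shows "i div b < a" "i mod b < b"
proof -
  from assms have "b > 0" by (cases b) auto
  then show "i mod b < b" by simp
  show "i div b < a" using assms by (simp add: less_mult_imp_div_less)
qed

text \<open>The mixed-product rule: the inner summation index splits into quotient and remainder,
  after which the double sum factors into two ordinary matrix products.\<close>

lemma kron_mult:
  fixes A :: "'a::comm_semiring_1 mat"
  assumes "dim_col A = dim_row C" "dim_col B = dim_row D"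
  shows "(A \<otimes>\<^sub>K B) * (C \<otimes>\<^sub>K D) = (A * C) \<otimes>\<^sub>K (B * D)"
proof (rule eq_matI)
  fix i j assume "i < dim_row ((A * C) \<otimes>\<^sub>K (B * D))" "j < dim_col ((A * C) \<otimes>\<^sub>K (B * D))"
  then have i: "i < dim_row A * dim_row B" and j: "j < dim_col C * dim_col D" by auto
  note ij = div_mod_less_mult [OF i] div_mod_less_mult [OF j]
  define f where "f k l = A $$ (i div dim_row B, k) * B $$ (i mod dim_row B, l)
      * (C $$ (k, j div dim_col D) * D $$ (l, j mod dim_col D))" for k l
  have "((A \<otimes>\<^sub>K B) * (C \<otimes>\<^sub>K D)) $$ (i, j)
      = (\<Sum>k<dim_row C * dim_row D. f (k div dim_row D) (k mod dim_row D))"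
    using i j assms by (simp add: scalar_prod_def lessThan_atLeast0 f_def)
  also have "\<dots> = (\<Sum>k<dim_row C. \<Sum>l<dim_row D. f k l)"
    by (rule sum_div_mod)
  also have "\<dots> = ((A * C) \<otimes>\<^sub>K (B * D)) $$ (i, j)"
    using i j ij assms
    by (simp add: scalar_prod_def lessThan_atLeast0 f_def sum_product mult_ac)
  finally show "((A \<otimes>\<^sub>K B) * (C \<otimes>\<^sub>K D)) $$ (i, j) = ((A * C) \<otimes>\<^sub>K (B * D)) $$ (i, j)" .
qed auto

lemma mat_adjoint_kron:
  fixes A :: "complex mat"
  shows "mat_adjoint (A \<otimes>\<^sub>K B) = mat_adjoint A \<otimes>\<^sub>K mat_adjoint B"
  by (intro eq_matI) (auto simp: div_mod_less_mult)

lemma kron_smult_left: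
  fixes A :: "'a::comm_semiring_1 mat"
  shows "(c \<cdot>\<^sub>m A) \<otimes>\<^sub>K B = c \<cdot>\<^sub>m (A \<otimes>\<^sub>K B)"
  by (intro eq_matI) (auto simp: div_mod_less_mult mult_ac)

lemma kron_smult_right:
  fixes A :: "'a::comm_semiring_1 mat"
  shows "A \<otimes>\<^sub>K (c \<cdot>\<^sub>m B) = c \<cdot>\<^sub>m (A \<otimes>\<^sub>K B)"
  by (intro eq_matI) (auto simp: div_mod_less_mult mult_ac)

lemma kron_one: "1\<^sub>m m \<otimes>\<^sub>K 1\<^sub>m n = (1\<^sub>m (m * n) :: 'a::comm_semiring_1 mat)"
proof (rule eq_matI)
  fix i j assume "i < dim_row (1\<^sub>m (m * n) :: 'a mat)" "j < dim_col (1\<^sub>m (m * n) :: 'a mat)"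
  then have ij: "i < m * n" "j < m * n" by auto
  have "i = j \<longleftrightarrow> i div n = j div n \<and> i mod n = j mod n"
    by (metis div_mult_mod_eq)
  with ij show "(1\<^sub>m m \<otimes>\<^sub>K 1\<^sub>m n) $$ (i, j) = (1\<^sub>m (m * n) :: 'a mat) $$ (i, j)"
    by (auto simp: div_mod_less_mult)
qed auto

lemma mat_tr_kron:
  fixes A :: "'a::comm_semiring_1 mat"
  assumes "A \<in> carrier_mat m m" "B \<in> carrier_mat n n"
  shows "mat_tr (A \<otimes>\<^sub>K B) = mat_tr A * mat_tr B"
  using assms sum_div_mod [of "\<lambda>i j. A $$ (i, i) * B $$ (j, j)" n m]
  by (simp add: mat_tr_def sum_product)

section \<open>Iterated Kronecker products\<close>

lemma kron_list_simps [simp]: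
  "kron_list [] = 1\<^sub>m 1" "kron_list (A # As) = A \<otimes>\<^sub>K kron_list As"
  by (auto simp: kron_list_def)

lemma kron_list_dim:
  assumes "set As \<subseteq> carrier_mat 2 2"
  shows "dim_row (kron_list As) = 2 ^ length As" "dim_col (kron_list As) = 2 ^ length As"
  using kron_list_carrier [OF assms] by auto

lemma kron_list_mult:
  fixes As :: "'a::comm_semiring_1 mat list"
  assumes "length As = length Bs" "set As \<subseteq> carrier_mat 2 2" "set Bs \<subseteq> carrier_mat 2 2"
  shows "kron_list As * kron_list Bs = kron_list (map2 (*) As Bs)"
  using assms by (induction As Bs rule: list_induct2) (auto simp: kron_mult kron_list_dim)

lemma mat_adjoint_kron_list:
  "mat_adjoint (kron_list As) = kron_list (map mat_adjoint As :: complex mat list)"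
  by (induction As) (auto simp: mat_adjoint_kron)

lemma mat_tr_kron_list:
  fixes As :: "'a::comm_semiring_1 mat list"
  assumes "set As \<subseteq> carrier_mat 2 2"
  shows "mat_tr (kron_list As) = prod_list (map mat_tr As)"
  using assms
proof (induction As)
  case (Cons A As)
  then show ?case
    using mat_tr_kron [of A 2 "kron_list As" "2 ^ length As"] kron_list_carrier [of As] by auto
qed (simp add: mat_tr_def)

lemma kron_list_one:
  "kron_list (replicate n (1\<^sub>m 2)) = (1\<^sub>m (2 ^ n) :: 'a::comm_semiring_1 mat)"
  by (induction n) (auto simp: kron_one)

lemma kron_list_update_smult:
  fixes As :: "'a::comm_semiring_1 mat list"
  assumes "k < length As"
  shows "kron_list (As[k := c \<cdot>\<^sub>m A]) = c \<cdot>\<^sub>m kron_list (As[k := A])"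
  using assms
  by (induction As arbitrary: k) (auto simp: kron_smult_left kron_smult_right split: nat.split)

text \<open>The signs of the factors multiply to a sign, so commutation up to sign can be checked
  one qubit at a time.\<close>

lemma kron_list_smult:
  fixes As Bs :: "complex mat list"
  assumes "list_all2 (\<lambda>A B. \<exists>s\<in>{1, - 1}. A = s \<cdot>\<^sub>m B) As Bs"
  shows "\<exists>s\<in>{1, - 1}. kron_list As = s \<cdot>\<^sub>m kron_list Bs"
  using assms
proof (induction As Bs rule: list_all2_induct)
  case Nil
  then show ?case by (auto intro: exI [of _ 1])
next
  case (Cons A As B Bs)
  then obtain s t where st: "s \<in> {1, - 1}" "t \<in> {1, - 1}" "A = s \<cdot>\<^sub>m B"
    "kron_list As = t \<cdot>\<^sub>m kron_list Bs" by blast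
  then have "kron_list (A # As) = (s * t) \<cdot>\<^sub>m kron_list (B # Bs)"
    by (auto simp: kron_smult_left kron_smult_right intro!: eq_matI)
  moreover have "s * t \<in> {1, - 1}" using st by auto
  ultimately show ?case by blast
qed

section \<open>Orthogonality and completeness of the Pauli operators\<close>

text \<open>Tensor products are linear in each factor. This later merges the two control projectors
  into an identity in the proof that CNOT is unitary.\<close>

lemma kron_list_update_add:
  fixes As :: "'a::comm_semiring_1 mat list"
  assumes "k < length As" "A \<in> carrier_mat m n" "B \<in> carrier_mat m n"
  shows "kron_list (As[k := A + B]) = kron_list (As[k := A]) + kron_list (As[k := B])"
  using assms
proof (induction As arbitrary: k)
  case (Cons C Cs)
  show ?case
  proof (cases k)
    case 0
    then show ?thesis
      using Cons.prems by (intro eq_matI) (auto simp: div_mod_less_mult distrib_right)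
  next
    case (Suc l)
    have dims: "dim_row (kron_list (Cs[l := A])) = dim_row (kron_list (Cs[l := B]))"
      "dim_col (kron_list (Cs[l := A])) = dim_col (kron_list (Cs[l := B]))"
      using \<open>A \<in> carrier_mat m n\<close> \<open>B \<in> carrier_mat m n\<close>
      by (induction Cs arbitrary: l) (auto split: nat.split)
    show ?thesis
      using Cons Suc by (intro eq_matI) (auto simp: div_mod_less_mult distrib_left dims)
  qed
qed simp

section \<open>Two-by-two matrices and single-qubit Paulis\<close>

lemma mat2_carrier [simp]: "mat2 a b c d \<in> carrier_mat 2 2"
  by (auto simp: mat_of_rows_list_def)

lemma mat2_index [simp]:
  "mat2 a b c d $$ (0, 0) = a" "mat2 a b c d $$ (0, Suc 0) = b"
  "mat2 a b c d $$ (Suc 0, 0) = c" "mat2 a b c d $$ (Suc 0, Suc 0) = d"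
  by (auto simp: mat_of_rows_list_def)

lemma mat2_dim [simp]: "dim_row (mat2 a b c d) = 2" "dim_col (mat2 a b c d) = 2"
  by (auto simp: mat_of_rows_list_def)

lemma mat2_eqI:
  assumes "A \<in> carrier_mat 2 2" "B \<in> carrier_mat 2 2"
    "A $$ (0, 0) = B $$ (0, 0)" "A $$ (0, 1) = B $$ (0, 1)"
    "A $$ (1, 0) = B $$ (1, 0)" "A $$ (1, 1) = B $$ (1, 1)"
  shows "A = B"
  using assms by (intro eq_matI) (auto simp: less_2_cases_iff)

text \<open>As a simp rule, together with the closed forms for products, scalings and adjoints
  below, this reduces every identity between explicit gates to scalar equations between
  entries.\<close>

lemma mat2_eq_iff [simp]:
  "mat2 a b c d = mat2 a' b' c' d' \<longleftrightarrow> a = a' \<and> b = b' \<and> c = c' \<and> d = d'"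
  by (metis mat2_index)

lemma sum_two:
  fixes f :: "nat \<Rightarrow> 'a::comm_monoid_add"
  shows "sum f {..<2} = f 0 + f 1" "sum f {0..<2} = f 0 + f 1"
  by (auto simp: eval_nat_numeral)

lemma mat2_mult [simp]:
  "mat2 a b c d * mat2 a' b' c' d'
    = mat2 (a * a' + b * c') (a * b' + b * d') (c * a' + d * c') (c * b' + d * d')"
  by (rule mat2_eqI) (auto simp: scalar_prod_def sum_two intro!: mult_carrier_mat)

lemma mat2_add [simp]:
  "mat2 a b c d + mat2 a' b' c' d' = mat2 (a + a') (b + b') (c + c') (d + d')"
  by (rule mat2_eqI) auto

lemma mat2_smult [simp]: "k \<cdot>\<^sub>m mat2 a b c d = mat2 (k * a) (k * b) (k * c) (k * d)"
  by (rule mat2_eqI) auto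

lemma mat2_adjoint [simp]: "mat_adjoint (mat2 a b c d) = mat2 (cnj a) (cnj c) (cnj b) (cnj d)"
  by (rule mat2_eqI) auto

lemma mat2_tr [simp]: "mat_tr (mat2 a b c d) = a + d"
  by (simp add: mat_tr_def sum_two)

lemma mat2_one: "1\<^sub>m 2 = mat2 1 0 0 1"
  by (rule mat2_eqI) auto

lemmas pauli_mat2 = mat2_one Pauli_X_def Pauli_Y_def Pauli_Z_def

definition paulis1 :: "complex mat set" where
  "paulis1 = {1\<^sub>m 2, Pauli_X, Pauli_Y, Pauli_Z}"

text \<open>Lists of factors, as opposed to their products, allow induction on the number of qubits;
  \<open>inj_on_kron_list_pauli\<close> carries the results over to matrices.\<close>

definition pauli_lists :: "nat \<Rightarrow> complex mat list set" where
  "pauli_lists n = {Qs. set Qs \<subseteq> paulis1 \<and> length Qs = n}"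

lemma paulis1_carrier: "paulis1 \<subseteq> carrier_mat 2 2"
  by (auto simp: paulis1_def pauli_mat2)

lemma pauli_ops_eq: "pauli_ops n = kron_list ` pauli_lists n"
  unfolding pauli_ops_def pauli_lists_def paulis1_def by auto

lemma pauli_lists_carrier:
  assumes "Qs \<in> pauli_lists n"
  shows "set Qs \<subseteq> carrier_mat 2 2" "length Qs = n" "kron_list Qs \<in> carrier_mat (2 ^ n) (2 ^ n)"
  using assms paulis1_carrier kron_list_carrier [of Qs] by (auto simp: pauli_lists_def)

lemma paulis1_commute:
  assumes "A \<in> paulis1" "B \<in> paulis1"
  shows "\<exists>s\<in>{1, - 1}. A * B = s \<cdot>\<^sub>m (B * A)"
  using assms by (auto simp: paulis1_def pauli_mat2)

lemma paulis1_adjoint: "A \<in> paulis1 \<Longrightarrow> mat_adjoint A = A"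
  by (auto simp: paulis1_def pauli_mat2)

lemma paulis1_square: "A \<in> paulis1 \<Longrightarrow> A * A = 1\<^sub>m 2"
  by (auto simp: paulis1_def pauli_mat2)

lemma paulis1_tr_mult:
  assumes "A \<in> paulis1" "B \<in> paulis1"
  shows "mat_tr (A * B) = (if A = B then 2 else 0)"
  using assms by (auto simp: paulis1_def pauli_mat2 complex_eq_iff)

text \<open>Completeness of the Pauli basis: \<open>\<Sum> Q \<otimes> Q\<close> is twice the swap
  operator on two qubits, here written out in entries.\<close>

lemma paulis1_swap:
  assumes "a < 2" "b < 2" "c < 2" "d < 2"
  shows "(\<Sum>Q\<in>paulis1. Q $$ (a, b) * Q $$ (c, d)) = (if a = d \<and> b = c then 2 else 0)"
proof -
  \<comment> \<open>Replacing the sum over a set by a sum over a list uses that the four matrices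
    are pairwise distinct, which their entries decide.\<close>
  have "(\<Sum>Q\<in>paulis1. Q $$ (a, b) * Q $$ (c, d))
    = (\<Sum>Q\<leftarrow>[mat2 1 0 0 1, mat2 0 1 1 0, mat2 0 (- \<i>) \<i> 0, mat2 1 0 0 (- 1)].
        Q $$ (a, b) * Q $$ (c, d))"
    unfolding paulis1_def pauli_mat2 by (simp add: complex_eq_iff)
  also have "\<dots> = (if a = d \<and> b = c then 2 else 0)"
    using assms by (auto simp: less_2_cases_iff)
  finally show ?thesis .
qed

section \<open>Pauli operators on \<open>n\<close> qubits\<close>

lemma pauli_lists_map2:
  assumes "Ps \<in> pauli_lists n" "Qs \<in> pauli_lists n"
  shows "kron_list Ps * kron_list Qs = kron_list (map2 (*) Ps Qs)"
  using assms pauli_lists_carrier by (intro kron_list_mult) auto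

lemma pauli_adjoint: "P \<in> pauli_ops n \<Longrightarrow> mat_adjoint P = P"
  unfolding pauli_ops_eq pauli_lists_def
  by (auto simp: mat_adjoint_kron_list paulis1_adjoint subset_iff intro!: arg_cong [of _ _ kron_list] map_idI)

lemma pauli_square:
  assumes "P \<in> pauli_ops n"
  shows "P * P = 1\<^sub>m (2 ^ n)"
proof -
  obtain Ps where Ps: "P = kron_list Ps" "Ps \<in> pauli_lists n"
    using assms by (auto simp: pauli_ops_eq)
  have "map2 (*) Ps Ps = replicate n (1\<^sub>m 2)"
    using Ps(2) by (intro nth_equalityI) (auto simp: pauli_lists_def intro!: paulis1_square)
  with Ps show ?thesis by (simp add: pauli_lists_map2 kron_list_one)
qed

lemma pauli_commute:
  assumes "P \<in> pauli_ops n" "Q \<in> pauli_ops n"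
  shows "\<exists>s\<in>{1, - 1}. P * Q = s \<cdot>\<^sub>m (Q * P)"
proof -
  obtain Ps Qs where PQ: "P = kron_list Ps" "Ps \<in> pauli_lists n" "Q = kron_list Qs" "Qs \<in> pauli_lists n"
    using assms by (auto simp: pauli_ops_eq)
  have "list_all2 (\<lambda>A B. \<exists>s\<in>{1, - 1}. A = s \<cdot>\<^sub>m B) (map2 (*) Ps Qs) (map2 (*) Qs Ps)"
    unfolding list_all2_conv_all_nth
  proof (intro conjI allI impI)
    fix i assume "i < length (map2 (*) Ps Qs)"
    then have i: "i < length Ps" "i < length Qs" "Ps ! i \<in> paulis1" "Qs ! i \<in> paulis1"
      using PQ by (auto simp: pauli_lists_def)
    show "\<exists>s\<in>{1, - 1}. map2 (*) Ps Qs ! i = s \<cdot>\<^sub>m map2 (*) Qs Ps ! i"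
      using paulis1_commute [OF i(3,4)] i(1,2) by simp
  qed simp
  from kron_list_smult [OF this] show ?thesis
    using PQ by (simp add: pauli_lists_map2)
qed

text \<open>The trace of a tensor product is the product of the traces: a position where the lists
  differ contributes a factor 0, any other position a factor 2.\<close>

lemma pauli_lists_tr_mult:
  assumes "Ps \<in> pauli_lists n" "Qs \<in> pauli_lists n"
  shows "mat_tr (kron_list Ps * kron_list Qs) = (if Ps = Qs then 2 ^ n else 0)"
proof -
  have "set (map2 (*) Ps Qs) \<subseteq> carrier_mat 2 2"
    using pauli_lists_carrier(1) [OF assms(1)] pauli_lists_carrier(1) [OF assms(2)]
    by (auto dest: set_zip_leftD set_zip_rightD intro!: mult_carrier_mat [of _ 2 2 _ 2])
  then have "mat_tr (kron_list Ps * kron_list Qs) = prod_list (map mat_tr (map2 (*) Ps Qs))"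
    using assms by (simp add: pauli_lists_map2 mat_tr_kron_list)
  also have "\<dots> = (if Ps = Qs then 2 ^ n else 0)"
    using assms
  proof (induction n arbitrary: Ps Qs)
    case (Suc n)
    obtain A As where "Ps = A # As" using Suc.prems by (cases Ps) (auto simp: pauli_lists_def)
    moreover obtain B Bs where "Qs = B # Bs" using Suc.prems by (cases Qs) (auto simp: pauli_lists_def)
    ultimately show ?case
      using Suc.prems Suc.IH [of As Bs] by (auto simp: pauli_lists_def paulis1_tr_mult)
  qed (auto simp: pauli_lists_def)
  finally show ?thesis .
qed

text \<open>If the two products agree, pairing the first with either of them gives the same nonzero
  trace, and orthogonality then forces the lists to be equal.\<close>

lemma inj_on_kron_list_pauli: "inj_on kron_list (pauli_lists n)"
proof (rule inj_onI)
  fix Ps Qs assume PQ: "Ps \<in> pauli_lists n" "Qs \<in> pauli_lists n" "kron_list Ps = kron_list Qs"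
  then have "mat_tr (kron_list Ps * kron_list Qs) = mat_tr (kron_list Ps * kron_list Ps)" by simp
  then show "Ps = Qs"
    using PQ(1,2) by (simp add: pauli_lists_tr_mult split: if_splits)
qed

lemma pauli_tr_mult:
  assumes "P \<in> pauli_ops n" "Q \<in> pauli_ops n"
  shows "mat_tr (P * Q) = (if P = Q then 2 ^ n else 0)"
  using assms inj_on_kron_list_pauli [of n]
  by (auto simp: pauli_ops_eq pauli_lists_tr_mult inj_on_def)

text \<open>The \<open>n\<close>-qubit version of \<open>paulis1_swap\<close>, by induction: the
  first factor sees the quotients of the indices by \<open>2 ^ n\<close> and the other factors see
  the remainders, so the sum splits into a product.\<close>

lemma pauli_lists_swap:
  assumes "a < 2 ^ n" "b < 2 ^ n" "c < 2 ^ n" "d < 2 ^ n"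
  shows "(\<Sum>Qs\<in>pauli_lists n. kron_list Qs $$ (a, b) * kron_list Qs $$ (c, d))
    = (if a = d \<and> b = c then 2 ^ n else 0)"
  using assms
proof (induction n arbitrary: a b c d)
  case 0
  have "pauli_lists 0 = {[]}" by (auto simp: pauli_lists_def)
  with 0 show ?case by simp
next
  case (Suc n)
  let ?m = "2 ^ n :: nat"
  let ?k = "\<lambda>Qs. kron_list Qs"
  have lists: "pauli_lists (Suc n) = (\<lambda>(Qs, Q). Q # Qs) ` (pauli_lists n \<times> paulis1)"
    unfolding pauli_lists_def by (rule lists_length_Suc_eq)
  have inj: "inj_on (\<lambda>(Qs, Q). Q # Qs) (pauli_lists n \<times> paulis1)"
    by (auto simp: inj_on_def)
  have lt: "x div ?m < 2" "x mod ?m < ?m" if "x < 2 ^ Suc n" for x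
    using div_mod_less_mult [of x 2 ?m] that by auto
  have idx: "?k (Q # Qs) $$ (x, y) = Q $$ (x div ?m, y div ?m) * ?k Qs $$ (x mod ?m, y mod ?m)"
    if "Qs \<in> pauli_lists n" "Q \<in> paulis1" "x < 2 ^ Suc n" "y < 2 ^ Suc n" for Q Qs x y
    using that pauli_lists_carrier(3) [OF that(1)] paulis1_carrier by (auto simp: subset_iff)
  have "(\<Sum>Qs\<in>pauli_lists (Suc n). ?k Qs $$ (a, b) * ?k Qs $$ (c, d))
    = (\<Sum>(Qs, Q)\<in>pauli_lists n \<times> paulis1. ?k (Q # Qs) $$ (a, b) * ?k (Q # Qs) $$ (c, d))"
    unfolding lists by (subst sum.reindex [OF inj]) (simp add: case_prod_unfold)
  also have "\<dots> = (\<Sum>(Qs, Q)\<in>pauli_lists n \<times> paulis1.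
      (?k Qs $$ (a mod ?m, b mod ?m) * ?k Qs $$ (c mod ?m, d mod ?m))
      * (Q $$ (a div ?m, b div ?m) * Q $$ (c div ?m, d div ?m)))"
    using Suc.prems by (intro sum.cong) (auto simp del: kron_list_simps simp: idx)
  also have "\<dots> = (\<Sum>Qs\<in>pauli_lists n. ?k Qs $$ (a mod ?m, b mod ?m) * ?k Qs $$ (c mod ?m, d mod ?m))
      * (\<Sum>Q\<in>paulis1. Q $$ (a div ?m, b div ?m) * Q $$ (c div ?m, d div ?m))"
    by (simp add: sum_product sum.cartesian_product)
  also have "\<dots> = (if a mod ?m = d mod ?m \<and> b mod ?m = c mod ?m then 2 ^ n else 0)
      * (if a div ?m = d div ?m \<and> b div ?m = c div ?m then 2 else 0)"
    using Suc.prems by (simp add: Suc.IH paulis1_swap lt)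
  also have "\<dots> = (if a = d \<and> b = c then 2 ^ Suc n else 0)"
    by (auto) (metis div_mult_mod_eq)+
  finally show ?case .
qed

lemma pauli_swap:
  assumes "a < 2 ^ n" "b < 2 ^ n" "c < 2 ^ n" "d < 2 ^ n"
  shows "(\<Sum>Q\<in>pauli_ops n. Q $$ (a, b) * Q $$ (c, d)) = (if a = d \<and> b = c then 2 ^ n else 0)"
  unfolding pauli_ops_eq sum.reindex [OF inj_on_kron_list_pauli]
  using pauli_lists_swap [OF assms] by simp

section \<open>Conjugation of Paulis by Cliffords\<close>

lemma unitary_matD:
  assumes "unitary_mat N U"
  shows "U \<in> carrier_mat N N" "mat_adjoint U \<in> carrier_mat N N"
    "U * mat_adjoint U = 1\<^sub>m N" "mat_adjoint U * U = 1\<^sub>m N"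
  using assms by (auto simp: unitary_mat_def)

lemma unitary_mat_adjoint: "unitary_mat N U \<Longrightarrow> unitary_mat N (mat_adjoint U)"
  by (auto simp: unitary_mat_def)

lemma unitary_mat_cancel:
  assumes "unitary_mat N U" "A \<in> carrier_mat N m"
  shows "mat_adjoint U * (U * A) = A" "U * (mat_adjoint U * A) = A"
  using unitary_matD [OF assms(1)] assms(2)
  by (simp_all flip: assoc_mult_mat [of _ N N _ N _ m])

lemma unitary_mat_mult:
  assumes U: "unitary_mat N U" and V: "unitary_mat N V"
  shows "unitary_mat N (U * V)"
proof -
  note c = unitary_matD [OF U] unitary_matD [OF V]
  have "U * V * (mat_adjoint V * mat_adjoint U) = U * (V * (mat_adjoint V * mat_adjoint U))"
    using c by (intro assoc_mult_mat) auto
  moreover have "mat_adjoint V * mat_adjoint U * (U * V) = mat_adjoint V * (mat_adjoint U * (U * V))"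
    using c by (intro assoc_mult_mat) auto
  ultimately show ?thesis
    using c by (simp add: unitary_mat_def mat_adjoint_mult unitary_mat_cancel [OF U] unitary_mat_cancel [OF V])
qed

lemma pauli_unitary: "P \<in> pauli_ops n \<Longrightarrow> unitary_mat (2 ^ n) P"
  using pauli_ops_carrier [of n] by (auto simp: unitary_mat_def pauli_adjoint pauli_square)

section \<open>Conjugation of Paulis up to sign\<close>

definition signed_paulis :: "nat \<Rightarrow> complex mat set" where
  "signed_paulis n = {s \<cdot>\<^sub>m P | s P. s \<in> {1, - 1} \<and> P \<in> pauli_ops n}"

text \<open>The adjoint stands on the left because the twirl produces conjugates of this form. Only
  an inclusion is demanded; surjectivity follows by finiteness in
  \<open>normalizes_paulis_adjoint\<close>.\<close>

definition normalizes_paulis :: "nat \<Rightarrow> complex mat \<Rightarrow> bool" where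
  "normalizes_paulis n U \<longleftrightarrow> unitary_mat (2 ^ n) U
     \<and> (\<forall>Q\<in>pauli_ops n. mat_adjoint U * Q * U \<in> signed_paulis n)"

lemma signed_paulisI: "s \<in> {1, - 1} \<Longrightarrow> P \<in> pauli_ops n \<Longrightarrow> s \<cdot>\<^sub>m P \<in> signed_paulis n"
  unfolding signed_paulis_def by blast

lemma smult_one [simp]: "1 \<cdot>\<^sub>m A = (A :: 'a::semiring_1 mat)"
  by (intro eq_matI) auto

lemma smult_smult_mat: "a \<cdot>\<^sub>m (b \<cdot>\<^sub>m A) = (a * b) \<cdot>\<^sub>m (A :: 'a::semiring_1 mat)"
  by (intro eq_matI) (auto simp: mult.assoc)

lemma pauli_signed: "P \<in> pauli_ops n \<Longrightarrow> P \<in> signed_paulis n"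
  using signed_paulisI [of 1 P n] by simp

lemma signed_paulis_carrier: "signed_paulis n \<subseteq> carrier_mat (2 ^ n) (2 ^ n)"
  using pauli_ops_carrier [of n] by (auto simp: signed_paulis_def)

lemma finite_signed_paulis: "finite (signed_paulis n)"
proof -
  have "signed_paulis n = (\<lambda>(s, P). s \<cdot>\<^sub>m P) ` ({1, - 1} \<times> pauli_ops n)"
    by (auto simp: signed_paulis_def)
  then show ?thesis by (simp add: finite_pauli_ops)
qed

lemma signed_paulis_smult:
  assumes "s \<in> {1, - 1}" "A \<in> signed_paulis n"
  shows "s \<cdot>\<^sub>m A \<in> signed_paulis n"
proof -
  obtain t P where "t \<in> {1, - 1}" "P \<in> pauli_ops n" "A = t \<cdot>\<^sub>m P"
    using assms(2) by (auto simp: signed_paulis_def)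
  moreover have "s * t \<in> {1, - 1}" using assms(1) calculation(1) by auto
  ultimately show ?thesis
    using signed_paulisI [of "s * t" P n] by (simp add: smult_smult_mat)
qed

lemma normalizes_paulis_signed:
  assumes "normalizes_paulis n U" "A \<in> signed_paulis n"
  shows "mat_adjoint U * A * U \<in> signed_paulis n"
proof -
  obtain s P where sP: "s \<in> {1, - 1}" "P \<in> pauli_ops n" "A = s \<cdot>\<^sub>m P"
    using assms(2) by (auto simp: signed_paulis_def)
  note c = unitary_matD [of "2 ^ n" U] sP pauli_ops_carrier [of n]
  have "mat_adjoint U * A * U = s \<cdot>\<^sub>m (mat_adjoint U * P * U)"
    using assms(1) c by (auto simp: normalizes_paulis_def subset_iff
        mult_smult_distrib [of _ "2 ^ n" "2 ^ n" _ "2 ^ n"]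
        mult_smult_assoc_mat [of _ "2 ^ n" "2 ^ n" _ "2 ^ n"]
        mult_carrier_mat [of _ "2 ^ n" "2 ^ n" _ "2 ^ n"])
  then show ?thesis
    using assms(1) sP by (auto simp: normalizes_paulis_def intro!: signed_paulis_smult)
qed

text \<open>Multiplying the relation by \<open>mat_adjoint U\<close> from the left isolates the
  conjugate. A gate can thus be checked by moving \<open>Q\<close> past it, without computing with
  adjoints.\<close>

lemma normalizes_paulisI:
  assumes U: "unitary_mat (2 ^ n) U"
    and *: "\<And>Q. Q \<in> pauli_ops n \<Longrightarrow> \<exists>s\<in>{1, - 1}. \<exists>R\<in>pauli_ops n. Q * U = s \<cdot>\<^sub>m (U * R)"
  shows "normalizes_paulis n U"
  unfolding normalizes_paulis_def
proof (intro conjI U ballI)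
  fix Q assume Q: "Q \<in> pauli_ops n"
  then obtain s R where sR: "s \<in> {1, - 1}" "R \<in> pauli_ops n" "Q * U = s \<cdot>\<^sub>m (U * R)"
    using * by blast
  note c = unitary_matD [OF U] subsetD [OF pauli_ops_carrier Q] subsetD [OF pauli_ops_carrier sR(2)]
  have "mat_adjoint U * Q * U = mat_adjoint U * (Q * U)"
    using c by (intro assoc_mult_mat) auto
  also have "\<dots> = s \<cdot>\<^sub>m (mat_adjoint U * (U * R))"
    unfolding sR(3) using c by (intro mult_smult_distrib) auto
  also have "mat_adjoint U * (U * R) = R"
    using c by (intro unitary_mat_cancel [OF U]) auto
  finally show "mat_adjoint U * Q * U \<in> signed_paulis n"
    using sR signed_paulisI by simp
qed

lemma normalizes_paulis_pauli:
  assumes "P \<in> pauli_ops n"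
  shows "normalizes_paulis n P"
  using assms pauli_commute [OF _ assms] by (intro normalizes_paulisI pauli_unitary) auto

lemma normalizes_paulis_mult:
  assumes U: "normalizes_paulis n U" and V: "normalizes_paulis n V"
  shows "normalizes_paulis n (U * V)"
  unfolding normalizes_paulis_def
proof (intro conjI ballI)
  have u: "unitary_mat (2 ^ n) U" "unitary_mat (2 ^ n) V"
    using U V by (auto simp: normalizes_paulis_def)
  then show "unitary_mat (2 ^ n) (U * V)" by (rule unitary_mat_mult)
  fix Q assume Q: "Q \<in> pauli_ops n"
  note c = unitary_matD [OF u(1)] unitary_matD [OF u(2)] subsetD [OF pauli_ops_carrier Q]
  have "mat_adjoint (U * V) * Q * (U * V) = mat_adjoint V * (mat_adjoint U * Q * U) * V"
    using c by (simp add: mat_adjoint_mult assoc_mult_mat [of _ "2 ^ n" "2 ^ n" _ "2 ^ n" _ "2 ^ n"]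
        mult_carrier_mat [of _ "2 ^ n" "2 ^ n" _ "2 ^ n"])
  then show "mat_adjoint (U * V) * Q * (U * V) \<in> signed_paulis n"
    using normalizes_paulis_signed [OF V] U Q by (simp add: normalizes_paulis_def)
qed

text \<open>Conjugation by \<open>U\<close> is an injective self-map of the finite set of signed Paulis, hence onto.\<close>

lemma normalizes_paulis_adjoint:
  assumes "normalizes_paulis n U"
  shows "normalizes_paulis n (mat_adjoint U)"
  unfolding normalizes_paulis_def
proof (intro conjI ballI)
  have U: "unitary_mat (2 ^ n) U"
    using assms by (simp add: normalizes_paulis_def)
  then show "unitary_mat (2 ^ n) (mat_adjoint U)" by (rule unitary_mat_adjoint)
  let ?f = "\<lambda>A. mat_adjoint U * A * U"
  note c = unitary_matD [OF U] signed_paulis_carrier [of n]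
  have inv: "U * ?f A * mat_adjoint U = A" if "A \<in> signed_paulis n" for A
    using c that unitary_mat_cancel [OF U]
    by (auto simp: subset_iff assoc_mult_mat [of _ "2 ^ n" "2 ^ n" _ "2 ^ n" _ "2 ^ n"]
        mult_carrier_mat [of _ "2 ^ n" "2 ^ n" _ "2 ^ n"])
  have "inj_on ?f (signed_paulis n)"
    by (rule inj_on_inverseI [of _ "\<lambda>A. U * A * mat_adjoint U"]) (rule inv)
  moreover have "?f ` signed_paulis n \<subseteq> signed_paulis n"
    using normalizes_paulis_signed [OF assms] by auto
  ultimately have "?f ` signed_paulis n = signed_paulis n"
    by (intro endo_inj_surj finite_signed_paulis)
  moreover fix Q assume "Q \<in> pauli_ops n"
  ultimately obtain A where "A \<in> signed_paulis n" "Q = ?f A"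
    using pauli_signed by blast
  then show "mat_adjoint (mat_adjoint U) * Q * mat_adjoint U \<in> signed_paulis n"
    using inv by simp
qed

section \<open>Gates on a single qubit\<close>

lemma mult_one_nth:
  assumes "set Qs \<subseteq> carrier_mat 2 2" "i < length Qs"
  shows "1\<^sub>m 2 * Qs ! i = (Qs ! i :: complex mat)" "Qs ! i * 1\<^sub>m 2 = Qs ! i"
proof -
  have "Qs ! i \<in> carrier_mat 2 2" using assms nth_mem by blast
  then show "1\<^sub>m 2 * Qs ! i = Qs ! i" "Qs ! i * 1\<^sub>m 2 = Qs ! i" by simp_all
qed

lemma map2_replicate_update:
  fixes Qs :: "complex mat list"
  assumes "length Qs = n" "set Qs \<subseteq> carrier_mat 2 2" "k < n"
  shows "map2 (*) ((replicate n (1\<^sub>m 2))[k := u]) Qs = Qs[k := u * Qs ! k]"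
    "map2 (*) Qs ((replicate n (1\<^sub>m 2))[k := u]) = Qs[k := Qs ! k * u]"
  using assms by (auto intro!: nth_equalityI simp: nth_list_update mult_one_nth)

lemma set_replicate_update:
  assumes "u \<in> carrier_mat 2 2"
  shows "set ((replicate n (1\<^sub>m 2))[k := u]) \<subseteq> carrier_mat 2 2"
  using assms by (auto dest!: set_update_subset_insert [THEN subsetD])

lemma on_qubit_mult:
  assumes "set Qs \<subseteq> carrier_mat 2 2" "length Qs = n" "u \<in> carrier_mat 2 2" "k < n"
  shows "on_qubit n k u * kron_list Qs = kron_list (Qs[k := u * Qs ! k])"
    "kron_list Qs * on_qubit n k u = kron_list (Qs[k := Qs ! k * u])"
  using assms set_replicate_update [of u n k]
  by (simp_all add: on_qubit_def kron_list_mult map2_replicate_update)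

lemma on_qubit_mult_on_qubit:
  assumes "u \<in> carrier_mat 2 2" "v \<in> carrier_mat 2 2" "k < n"
  shows "on_qubit n k u * on_qubit n k v = on_qubit n k (u * v)"
  using on_qubit_mult(1) [OF set_replicate_update [OF assms(2)], of n k n u k] assms
  by (simp add: on_qubit_def)

lemma mat_adjoint_on_qubit: "mat_adjoint (on_qubit n k u) = on_qubit n k (mat_adjoint u)"
  by (simp add: on_qubit_def mat_adjoint_kron_list map_update)

lemma on_qubit_carrier: "u \<in> carrier_mat 2 2 \<Longrightarrow> on_qubit n k u \<in> carrier_mat (2 ^ n) (2 ^ n)"
  using kron_list_carrier [OF set_replicate_update] by (simp add: on_qubit_def)

lemma on_qubit_one: "on_qubit n k (1\<^sub>m 2) = 1\<^sub>m (2 ^ n)"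
proof -
  have "(replicate n (1\<^sub>m 2))[k := 1\<^sub>m 2] = replicate n (1\<^sub>m 2 :: complex mat)"
    by (cases "k < n") (auto intro!: nth_equalityI simp: nth_list_update)
  then show ?thesis by (simp add: on_qubit_def kron_list_one)
qed

lemma pauli_lists_update:
  assumes "Qs \<in> pauli_lists n" "A \<in> paulis1"
  shows "Qs[k := A] \<in> pauli_lists n"
  using assms set_update_subset_insert [of Qs k A] by (auto simp: pauli_lists_def)

text \<open>The gate touches only the \<open>k\<close>-th tensor factor, so a relation between
  single-qubit matrices lifts: replace that factor by \<open>B\<close> and pull the sign out of the
  product.\<close>

lemma normalizes_paulis_on_qubit:
  assumes k: "k < n" and u: "unitary_mat 2 u"
    and *: "\<And>A. A \<in> paulis1 \<Longrightarrow> \<exists>s\<in>{1, - 1}. \<exists>B\<in>paulis1. A * u = s \<cdot>\<^sub>m (u * B)"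
  shows "normalizes_paulis n (on_qubit n k u)"
proof (rule normalizes_paulisI)
  note c = unitary_matD [OF u]
  show "unitary_mat (2 ^ n) (on_qubit n k u)"
    using c k by (simp add: unitary_mat_def on_qubit_carrier mat_adjoint_on_qubit
        on_qubit_mult_on_qubit on_qubit_one)
  fix Q assume "Q \<in> pauli_ops n"
  then obtain Qs where Q: "Q = kron_list Qs" "Qs \<in> pauli_lists n" by (auto simp: pauli_ops_eq)
  then have "Qs ! k \<in> paulis1" using k by (auto simp: pauli_lists_def)
  then obtain s B where sB: "s \<in> {1, - 1}" "B \<in> paulis1" "Qs ! k * u = s \<cdot>\<^sub>m (u * B)"
    using * by blast
  note Q' = pauli_lists_update [OF Q(2) sB(2), of k]
  note l = pauli_lists_carrier [OF Q(2)] and l' = pauli_lists_carrier [OF Q']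
  have "Q * on_qubit n k u = s \<cdot>\<^sub>m (on_qubit n k u * kron_list (Qs[k := B]))"
    using k sB l l'(1) c by (simp add: Q(1) on_qubit_mult kron_list_update_smult)
  with sB(1) Q' show "\<exists>s\<in>{1, - 1}. \<exists>R\<in>pauli_ops n. Q * on_qubit n k u = s \<cdot>\<^sub>m (on_qubit n k u * R)"
    unfolding pauli_ops_eq by blast
qed

text \<open>Conjugation exchanges \<open>X\<close> and \<open>Z\<close>; since
  \<open>Y = \<i> X Z\<close> and these anticommute, \<open>Y\<close> goes to
  \<open>- Y\<close>.\<close>

lemma normalizes_paulis_Hadamard:
  assumes "k < n"
  shows "normalizes_paulis n (on_qubit n k Hadamard)"
proof (rule normalizes_paulis_on_qubit [OF assms])
  have "complex_of_real (1 / sqrt 2) * complex_of_real (1 / sqrt 2) = 1 / 2"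
    by (simp flip: of_real_mult)
  then show "unitary_mat 2 Hadamard"
    by (simp add: unitary_mat_def Hadamard_def mat2_one)
  fix A assume "A \<in> paulis1"
  then consider "A = 1\<^sub>m 2" | "A = Pauli_X" | "A = Pauli_Y" | "A = Pauli_Z"
    by (auto simp: paulis1_def)
  then show "\<exists>s\<in>{1, - 1}. \<exists>B\<in>paulis1. A * Hadamard = s \<cdot>\<^sub>m (Hadamard * B)"
  proof cases
    case 1
    then show ?thesis
      by (intro bexI [of _ 1] bexI [of _ "1\<^sub>m 2"]) (simp_all add: paulis1_def pauli_mat2 Hadamard_def)
  next
    case 2
    then show ?thesis
      by (intro bexI [of _ 1] bexI [of _ Pauli_Z]) (simp_all add: paulis1_def pauli_mat2 Hadamard_def)
  next
    case 3
    then show ?thesis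
      by (intro bexI [of _ "- 1"] bexI [of _ Pauli_Y]) (simp_all add: paulis1_def pauli_mat2 Hadamard_def)
  next
    case 4
    then show ?thesis
      by (intro bexI [of _ 1] bexI [of _ Pauli_X]) (simp_all add: paulis1_def pauli_mat2 Hadamard_def)
  qed
qed

text \<open>The gate is diagonal and commutes with \<open>I\<close> and \<open>Z\<close>;
  conjugation sends \<open>X\<close> to \<open>- Y\<close> and \<open>Y\<close> to
  \<open>X\<close>.\<close>

lemma normalizes_paulis_Phase_S:
  assumes "k < n"
  shows "normalizes_paulis n (on_qubit n k Phase_S)"
proof (rule normalizes_paulis_on_qubit [OF assms])
  show "unitary_mat 2 Phase_S"
    by (simp add: unitary_mat_def Phase_S_def mat2_one)
  fix A assume "A \<in> paulis1"
  then consider "A = 1\<^sub>m 2" | "A = Pauli_X" | "A = Pauli_Y" | "A = Pauli_Z"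
    by (auto simp: paulis1_def)
  then show "\<exists>s\<in>{1, - 1}. \<exists>B\<in>paulis1. A * Phase_S = s \<cdot>\<^sub>m (Phase_S * B)"
  proof cases
    case 1
    then show ?thesis
      by (intro bexI [of _ 1] bexI [of _ "1\<^sub>m 2"]) (simp_all add: paulis1_def pauli_mat2 Phase_S_def)
  next
    case 2
    then show ?thesis
      by (intro bexI [of _ "- 1"] bexI [of _ Pauli_Y]) (simp_all add: paulis1_def pauli_mat2 Phase_S_def)
  next
    case 3
    then show ?thesis
      by (intro bexI [of _ 1] bexI [of _ Pauli_X]) (simp_all add: paulis1_def pauli_mat2 Phase_S_def)
  next
    case 4
    then show ?thesis
      by (intro bexI [of _ 1] bexI [of _ Pauli_Z]) (simp_all add: paulis1_def pauli_mat2 Phase_S_def)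
  qed
qed

section \<open>The CNOT gate\<close>

abbreviation Proj0 :: "complex mat" where "Proj0 \<equiv> mat2 1 0 0 0"
abbreviation Proj1 :: "complex mat" where "Proj1 \<equiv> mat2 0 0 0 1"

text \<open>The two alternatives are \<open>A\<close> commuting with the control projectors (\<open>A\<close> is \<open>I\<close> or \<open>Z\<close>) and
  \<open>A\<close> exchanging them (\<open>A\<close> is \<open>X\<close> or \<open>Y\<close>); \<open>A'\<close> and \<open>B'\<close> are the tensor factors of the conjugate of
  \<open>A \<otimes> B\<close> by CNOT, whose sign is \<open>s\<close>.\<close>

lemma CNOT_table:
  assumes "A \<in> paulis1" "B \<in> paulis1"
  shows "\<exists>A'\<in>paulis1. \<exists>B'\<in>paulis1. \<exists>s\<in>{1, - 1}. \<exists>a b c d. a * b = s \<and> c * d = s \<and>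
    (A * Proj0 = a \<cdot>\<^sub>m (Proj0 * A') \<and> B = b \<cdot>\<^sub>m B'
       \<and> A * Proj1 = c \<cdot>\<^sub>m (Proj1 * A') \<and> B * Pauli_X = d \<cdot>\<^sub>m (Pauli_X * B')
     \<or> A * Proj0 = a \<cdot>\<^sub>m (Proj1 * A') \<and> B = b \<cdot>\<^sub>m (Pauli_X * B')
       \<and> A * Proj1 = c \<cdot>\<^sub>m (Proj0 * A') \<and> B * Pauli_X = d \<cdot>\<^sub>m B')"
    (is "?T A B")
proof -
  have "?T (1\<^sub>m 2) (1\<^sub>m 2)"
    by (rule bexI [of _ "1\<^sub>m 2"], rule bexI [of _ "1\<^sub>m 2"], rule bexI [of _ "1"],
      rule exI [of _ "1"], rule exI [of _ "1"], rule exI [of _ "1"], rule exI [of _ "1"])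
      (simp_all add: paulis1_def pauli_mat2)
  moreover
  have "?T (1\<^sub>m 2) Pauli_X"
    by (rule bexI [of _ "1\<^sub>m 2"], rule bexI [of _ "Pauli_X"], rule bexI [of _ "1"],
      rule exI [of _ "1"], rule exI [of _ "1"], rule exI [of _ "1"], rule exI [of _ "1"])
      (simp_all add: paulis1_def pauli_mat2)
  moreover
  have "?T (1\<^sub>m 2) Pauli_Y"
    by (rule bexI [of _ "Pauli_Z"], rule bexI [of _ "Pauli_Y"], rule bexI [of _ "1"],
      rule exI [of _ "1"], rule exI [of _ "1"], rule exI [of _ "- 1"], rule exI [of _ "- 1"])
      (simp_all add: paulis1_def pauli_mat2)
  moreover
  have "?T (1\<^sub>m 2) Pauli_Z"
    by (rule bexI [of _ "Pauli_Z"], rule bexI [of _ "Pauli_Z"], rule bexI [of _ "1"],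
      rule exI [of _ "1"], rule exI [of _ "1"], rule exI [of _ "- 1"], rule exI [of _ "- 1"])
      (simp_all add: paulis1_def pauli_mat2)
  moreover
  have "?T Pauli_Z (1\<^sub>m 2)"
    by (rule bexI [of _ "Pauli_Z"], rule bexI [of _ "1\<^sub>m 2"], rule bexI [of _ "1"],
      rule exI [of _ "1"], rule exI [of _ "1"], rule exI [of _ "1"], rule exI [of _ "1"])
      (simp_all add: paulis1_def pauli_mat2)
  moreover
  have "?T Pauli_Z Pauli_X"
    by (rule bexI [of _ "Pauli_Z"], rule bexI [of _ "Pauli_X"], rule bexI [of _ "1"],
      rule exI [of _ "1"], rule exI [of _ "1"], rule exI [of _ "1"], rule exI [of _ "1"])
      (simp_all add: paulis1_def pauli_mat2)
  moreover
  have "?T Pauli_Z Pauli_Y"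
    by (rule bexI [of _ "1\<^sub>m 2"], rule bexI [of _ "Pauli_Y"], rule bexI [of _ "1"],
      rule exI [of _ "1"], rule exI [of _ "1"], rule exI [of _ "- 1"], rule exI [of _ "- 1"])
      (simp_all add: paulis1_def pauli_mat2)
  moreover
  have "?T Pauli_Z Pauli_Z"
    by (rule bexI [of _ "1\<^sub>m 2"], rule bexI [of _ "Pauli_Z"], rule bexI [of _ "1"],
      rule exI [of _ "1"], rule exI [of _ "1"], rule exI [of _ "- 1"], rule exI [of _ "- 1"])
      (simp_all add: paulis1_def pauli_mat2)
  moreover
  have "?T Pauli_X (1\<^sub>m 2)"
    by (rule bexI [of _ "Pauli_X"], rule bexI [of _ "Pauli_X"], rule bexI [of _ "1"],
      rule exI [of _ "1"], rule exI [of _ "1"], rule exI [of _ "1"], rule exI [of _ "1"])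
      (simp_all add: paulis1_def pauli_mat2)
  moreover
  have "?T Pauli_X Pauli_X"
    by (rule bexI [of _ "Pauli_X"], rule bexI [of _ "1\<^sub>m 2"], rule bexI [of _ "1"],
      rule exI [of _ "1"], rule exI [of _ "1"], rule exI [of _ "1"], rule exI [of _ "1"])
      (simp_all add: paulis1_def pauli_mat2)
  moreover
  \<comment> \<open>When \<open>A\<close> is \<open>X\<close> or \<open>Y\<close> and
    \<open>B\<close> is \<open>Y\<close> or \<open>Z\<close>, single factors pick up
    \<open>\<i>\<close> or \<open>- \<i>\<close>, as in \<open>Y = \<i> X Z\<close>. Only the
    products \<open>a * b\<close> and \<open>c * d\<close> have to equal the common sign.\<close>
  have "?T Pauli_X Pauli_Y"
    by (rule bexI [of _ "Pauli_Y"], rule bexI [of _ "Pauli_Z"], rule bexI [of _ "1"],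
      rule exI [of _ "- \<i>"], rule exI [of _ "\<i>"], rule exI [of _ "\<i>"], rule exI [of _ "- \<i>"])
      (simp_all add: paulis1_def pauli_mat2)
  moreover
  have "?T Pauli_X Pauli_Z"
    by (rule bexI [of _ "Pauli_Y"], rule bexI [of _ "Pauli_Y"], rule bexI [of _ "- 1"],
      rule exI [of _ "- \<i>"], rule exI [of _ "- \<i>"], rule exI [of _ "\<i>"], rule exI [of _ "\<i>"])
      (simp_all add: paulis1_def pauli_mat2)
  moreover
  have "?T Pauli_Y (1\<^sub>m 2)"
    by (rule bexI [of _ "Pauli_Y"], rule bexI [of _ "Pauli_X"], rule bexI [of _ "1"],
      rule exI [of _ "1"], rule exI [of _ "1"], rule exI [of _ "1"], rule exI [of _ "1"])
      (simp_all add: paulis1_def pauli_mat2)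
  moreover
  have "?T Pauli_Y Pauli_X"
    by (rule bexI [of _ "Pauli_Y"], rule bexI [of _ "1\<^sub>m 2"], rule bexI [of _ "1"],
      rule exI [of _ "1"], rule exI [of _ "1"], rule exI [of _ "1"], rule exI [of _ "1"])
      (simp_all add: paulis1_def pauli_mat2)
  moreover
  have "?T Pauli_Y Pauli_Y"
    by (rule bexI [of _ "Pauli_X"], rule bexI [of _ "Pauli_Z"], rule bexI [of _ "- 1"],
      rule exI [of _ "\<i>"], rule exI [of _ "\<i>"], rule exI [of _ "- \<i>"], rule exI [of _ "- \<i>"])
      (simp_all add: paulis1_def pauli_mat2)
  moreover
  have "?T Pauli_Y Pauli_Z"
    by (rule bexI [of _ "Pauli_X"], rule bexI [of _ "Pauli_Y"], rule bexI [of _ "1"],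
      rule exI [of _ "\<i>"], rule exI [of _ "- \<i>"], rule exI [of _ "- \<i>"], rule exI [of _ "\<i>"])
      (simp_all add: paulis1_def pauli_mat2)
  ultimately show ?thesis
    using assms unfolding paulis1_def by (elim insertE emptyE) (simp_all only:)
qed

text \<open>The explicit identity at the target gives both summands the same shape, so the
  two-position rules below apply to each.\<close>

lemma CNOT_eq:
  assumes "c < n" "t < n" "c \<noteq> t"
  shows "CNOT n c t = kron_list ((replicate n (1\<^sub>m 2))[c := Proj0, t := 1\<^sub>m 2])
    + kron_list ((replicate n (1\<^sub>m 2))[c := Proj1, t := Pauli_X])"
proof -
  have "(replicate n (1\<^sub>m 2))[c := Proj0] = (replicate n (1\<^sub>m 2))[c := Proj0, t := 1\<^sub>m 2 :: complex mat]"
    using assms by (intro nth_equalityI) (auto simp: nth_list_update)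
  then show ?thesis by (simp add: CNOT_def)
qed

lemma set_replicate_one: "set (replicate n (1\<^sub>m 2)) \<subseteq> carrier_mat 2 2"
  by auto

lemma set_update_two:
  assumes "x \<in> carrier_mat 2 2" "y \<in> carrier_mat 2 2" "set Qs \<subseteq> carrier_mat 2 2"
  shows "set (Qs[c := x, t := y]) \<subseteq> carrier_mat 2 2"
  using assms by (auto dest!: set_update_subset_insert [THEN subsetD])

lemma kron_list_update_two_mult:
  fixes Qs :: "complex mat list"
  assumes Qs: "set Qs \<subseteq> carrier_mat 2 2" "length Qs = n"
    and "x \<in> carrier_mat 2 2" "y \<in> carrier_mat 2 2" and ct: "c < n" "t < n" "c \<noteq> t"
  shows "kron_list ((replicate n (1\<^sub>m 2))[c := x, t := y]) * kron_list Qs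
      = kron_list (Qs[c := x * Qs ! c, t := y * Qs ! t])"
    "kron_list Qs * kron_list ((replicate n (1\<^sub>m 2))[c := x, t := y])
      = kron_list (Qs[c := Qs ! c * x, t := Qs ! t * y])"
proof -
  have "set ((replicate n (1\<^sub>m 2))[c := x, t := y]) \<subseteq> carrier_mat 2 2"
    using assms by (intro set_update_two) auto
  moreover have "map2 (*) ((replicate n (1\<^sub>m 2))[c := x, t := y]) Qs
      = Qs[c := x * Qs ! c, t := y * Qs ! t]"
    using Qs ct by (intro nth_equalityI) (auto simp: nth_list_update mult_one_nth)
  moreover have "map2 (*) Qs ((replicate n (1\<^sub>m 2))[c := x, t := y])
      = Qs[c := Qs ! c * x, t := Qs ! t * y]"
    using Qs ct by (intro nth_equalityI) (auto simp: nth_list_update mult_one_nth)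
  ultimately show "kron_list ((replicate n (1\<^sub>m 2))[c := x, t := y]) * kron_list Qs
      = kron_list (Qs[c := x * Qs ! c, t := y * Qs ! t])"
    "kron_list Qs * kron_list ((replicate n (1\<^sub>m 2))[c := x, t := y])
      = kron_list (Qs[c := Qs ! c * x, t := Qs ! t * y])"
    using Qs by (simp_all add: kron_list_mult)
qed

lemma kron_list_update_two_smult:
  fixes Qs :: "complex mat list"
  assumes "c < length Qs" "t < length Qs" "c \<noteq> t"
  shows "kron_list (Qs[c := a \<cdot>\<^sub>m x, t := b \<cdot>\<^sub>m y]) = (a * b) \<cdot>\<^sub>m kron_list (Qs[c := x, t := y])"
proof -
  have "kron_list (Qs[c := a \<cdot>\<^sub>m x, t := b \<cdot>\<^sub>m y]) = b \<cdot>\<^sub>m kron_list (Qs[t := y, c := a \<cdot>\<^sub>m x])"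
    using assms by (simp add: kron_list_update_smult list_update_swap)
  also have "\<dots> = b \<cdot>\<^sub>m (a \<cdot>\<^sub>m kron_list (Qs[t := y, c := x]))"
    using assms by (simp add: kron_list_update_smult)
  also have "\<dots> = (a * b) \<cdot>\<^sub>m kron_list (Qs[c := x, t := y])"
    using assms by (simp add: smult_smult_mat list_update_swap mult.commute)
  finally show ?thesis .
qed

text \<open>CNOT is self-adjoint, so it suffices that it squares to the identity. The cross terms
  vanish because \<open>Proj0\<close> and \<open>Proj1\<close> are orthogonal; the other two add up
  to the identity because \<open>X\<close> squares to the identity and the projectors sum to
  it.\<close>

lemma CNOT_unitary:
  assumes ct: "c < n" "t < n" "c \<noteq> t"
  shows "unitary_mat (2 ^ n) (CNOT n c t)"
proof -
  let ?K = "\<lambda>x y. kron_list ((replicate n (1\<^sub>m 2))[c := x, t := y]) :: complex mat"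
  have K: "?K x y \<in> carrier_mat (2 ^ n) (2 ^ n)"
    if "x \<in> carrier_mat 2 2" "y \<in> carrier_mat 2 2" for x y
    using kron_list_carrier [OF set_update_two [OF that set_replicate_one]] by auto
  have XK: "Pauli_X \<in> carrier_mat 2 2" "Pauli_X * Pauli_X = 1\<^sub>m 2" "mat_adjoint Pauli_X = Pauli_X"
    by (auto simp: pauli_mat2)
  have C: "CNOT n c t = ?K Proj0 (1\<^sub>m 2) + ?K Proj1 Pauli_X"
    by (rule CNOT_eq [OF ct])
  have adj: "mat_adjoint (CNOT n c t) = CNOT n c t"
    using K XK unfolding C
    by (subst mat_adjoint_add [of _ "2 ^ n" "2 ^ n"]) (auto simp: mat_adjoint_kron_list map_update)
  have mult: "?K x y * ?K x' y' = ?K (x * x') (y * y')"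
    if "x \<in> carrier_mat 2 2" "y \<in> carrier_mat 2 2" "x' \<in> carrier_mat 2 2" "y' \<in> carrier_mat 2 2"
    for x y x' y'
    using that ct kron_list_update_two_mult(1) [OF set_update_two [OF that(3,4) set_replicate_one], of n c t n x y c t]
    by (simp add: list_update_swap [of t c])
  \<comment> \<open>A zero factor equals 0 times itself; the scalar moves out of the tensor product
    and annihilates it.\<close>
  have zero: "?K (mat2 0 0 0 0) y = 0\<^sub>m (2 ^ n) (2 ^ n)" if "y \<in> carrier_mat 2 2" for y
  proof -
    have "?K (mat2 0 0 0 0) y = ?K (0 \<cdot>\<^sub>m mat2 0 0 0 0) (1 \<cdot>\<^sub>m y)" by simp
    also have "\<dots> = 0 \<cdot>\<^sub>m ?K (mat2 0 0 0 0) y"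
      using ct by (subst kron_list_update_two_smult) auto
    also have "\<dots> = 0\<^sub>m (2 ^ n) (2 ^ n)"
      using K [of "mat2 0 0 0 0", OF _ that] by (intro eq_matI) auto
    finally show ?thesis .
  qed
  have sum: "?K Proj0 (1\<^sub>m 2) + ?K Proj1 (1\<^sub>m 2) = 1\<^sub>m (2 ^ n)"
  proof -
    have "?K Proj0 (1\<^sub>m 2) + ?K Proj1 (1\<^sub>m 2) = ?K (Proj0 + Proj1) (1\<^sub>m 2)"
      using ct kron_list_update_add [of c "(replicate n (1\<^sub>m 2))[t := 1\<^sub>m 2]" Proj0 2 2 Proj1]
      by (simp add: list_update_swap [of t c])
    also have "(replicate n (1\<^sub>m 2))[c := Proj0 + Proj1, t := 1\<^sub>m 2] = replicate n (1\<^sub>m 2 :: complex mat)"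
      using ct by (intro nth_equalityI) (auto simp: nth_list_update mat2_one)
    finally show ?thesis by (simp add: kron_list_one)
  qed
  have "CNOT n c t * CNOT n c t = (?K Proj0 (1\<^sub>m 2) * ?K Proj0 (1\<^sub>m 2) + ?K Proj1 Pauli_X * ?K Proj0 (1\<^sub>m 2))
      + (?K Proj0 (1\<^sub>m 2) * ?K Proj1 Pauli_X + ?K Proj1 Pauli_X * ?K Proj1 Pauli_X)"
    unfolding C using K XK
    by (simp add: add_mult_distrib_mat [of _ "2 ^ n" "2 ^ n" _ _ "2 ^ n"]
        mult_add_distrib_mat [of _ "2 ^ n" "2 ^ n" _ "2 ^ n"])
  also have "\<dots> = 1\<^sub>m (2 ^ n)"
    using K XK sum by (simp add: mult zero)
  finally have "CNOT n c t * CNOT n c t = 1\<^sub>m (2 ^ n)" .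
  moreover have "CNOT n c t \<in> carrier_mat (2 ^ n) (2 ^ n)"
    unfolding C using K XK by simp
  ultimately show ?thesis by (simp add: unitary_mat_def adj)
qed

text \<open>Both \<open>Q * CNOT n c t\<close> and \<open>CNOT n c t * R\<close> are sums of two
  tensor products that differ from \<open>Q\<close> only at \<open>c\<close> and \<open>t\<close>.
  The table supplies the new factors and matches the summands with one common sign.\<close>

lemma normalizes_paulis_CNOT:
  assumes ct: "c < n" "t < n" "c \<noteq> t"
  shows "normalizes_paulis n (CNOT n c t)"
proof (rule normalizes_paulisI [OF CNOT_unitary [OF ct]])
  fix Q assume "Q \<in> pauli_ops n"
  then obtain Qs where Q: "Q = kron_list Qs" "Qs \<in> pauli_lists n" by (auto simp: pauli_ops_eq)
  note l = pauli_lists_carrier [OF Q(2)]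
  define A B where "A = Qs ! c" and "B = Qs ! t"
  have AB: "A \<in> paulis1" "B \<in> paulis1"
    using Q(2) ct by (auto simp: A_def B_def pauli_lists_def)
  from CNOT_table [OF AB] obtain A' B' s a b g d
    where A': "A' \<in> paulis1" and B': "B' \<in> paulis1" and s: "s \<in> {1, - 1}" "a * b = s" "g * d = s"
    and cases: "A * Proj0 = a \<cdot>\<^sub>m (Proj0 * A') \<and> B = b \<cdot>\<^sub>m B'
       \<and> A * Proj1 = g \<cdot>\<^sub>m (Proj1 * A') \<and> B * Pauli_X = d \<cdot>\<^sub>m (Pauli_X * B')
     \<or> A * Proj0 = a \<cdot>\<^sub>m (Proj1 * A') \<and> B = b \<cdot>\<^sub>m (Pauli_X * B')
       \<and> A * Proj1 = g \<cdot>\<^sub>m (Proj0 * A') \<and> B * Pauli_X = d \<cdot>\<^sub>m B'" by blast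
  define Rs where "Rs = Qs[c := A', t := B']"
  have Rs: "Rs \<in> pauli_lists n"
    unfolding Rs_def by (intro pauli_lists_update Q A' B')
  note l' = pauli_lists_carrier [OF Rs]
  let ?K = "\<lambda>x y. kron_list (Qs[c := x, t := y])"
  let ?G = "\<lambda>x y. kron_list ((replicate n (1\<^sub>m 2))[c := x, t := y]) :: complex mat"
  have c2: "A \<in> carrier_mat 2 2" "B \<in> carrier_mat 2 2" "A' \<in> carrier_mat 2 2" "B' \<in> carrier_mat 2 2"
    "Pauli_X \<in> carrier_mat 2 2"
    using AB A' B' paulis1_carrier by (auto simp: Pauli_X_def)
  have K: "?K x y \<in> carrier_mat (2 ^ n) (2 ^ n)"
    if "x \<in> carrier_mat 2 2" "y \<in> carrier_mat 2 2" for x y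
    using kron_list_carrier [OF set_update_two [OF that l(1)], of c t] l(2) by simp
  have G: "?G x y \<in> carrier_mat (2 ^ n) (2 ^ n)"
    if "x \<in> carrier_mat 2 2" "y \<in> carrier_mat 2 2" for x y
    using kron_list_carrier [OF set_update_two [OF that set_replicate_one]] by auto
  have smult: "?K (p \<cdot>\<^sub>m x) (q \<cdot>\<^sub>m y) = (p * q) \<cdot>\<^sub>m ?K x y" for p q x y
    using ct l(2) by (intro kron_list_update_two_smult) auto
  have left: "Q * CNOT n c t = ?K (A * Proj0) B + ?K (A * Proj1) (B * Pauli_X)"
  proof -
    have "Q * CNOT n c t = kron_list Qs * ?G Proj0 (1\<^sub>m 2) + kron_list Qs * ?G Proj1 Pauli_X"
      unfolding CNOT_eq [OF ct] Q(1) using G c2 l(3)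
      by (intro mult_add_distrib_mat [of _ "2 ^ n" "2 ^ n" _ "2 ^ n"]) auto
    then show ?thesis
      using l c2 ct by (simp add: kron_list_update_two_mult flip: A_def B_def)
  qed
  have right: "CNOT n c t * kron_list Rs = ?K (Proj0 * A') B' + ?K (Proj1 * A') (Pauli_X * B')"
  proof -
    have "CNOT n c t * kron_list Rs = ?G Proj0 (1\<^sub>m 2) * kron_list Rs + ?G Proj1 Pauli_X * kron_list Rs"
      unfolding CNOT_eq [OF ct] using G c2 l'(3)
      by (intro add_mult_distrib_mat [of _ "2 ^ n" "2 ^ n" _ _ "2 ^ n"]) auto
    moreover have "Rs ! c = A'" "Rs ! t = B'" "Rs[c := x, t := y] = Qs[c := x, t := y]" for x y
      using ct l(2) by (auto simp: Rs_def list_update_swap [of t c])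
    ultimately show ?thesis
      using l' c2 ct by (simp add: kron_list_update_two_mult)
  qed
  have "Q * CNOT n c t = s \<cdot>\<^sub>m (CNOT n c t * kron_list Rs)"
    using cases
  proof
    assume *: "A * Proj0 = a \<cdot>\<^sub>m (Proj0 * A') \<and> B = b \<cdot>\<^sub>m B'
       \<and> A * Proj1 = g \<cdot>\<^sub>m (Proj1 * A') \<and> B * Pauli_X = d \<cdot>\<^sub>m (Pauli_X * B')"
    have "Q * CNOT n c t
        = ?K (a \<cdot>\<^sub>m (Proj0 * A')) (b \<cdot>\<^sub>m B') + ?K (g \<cdot>\<^sub>m (Proj1 * A')) (d \<cdot>\<^sub>m (Pauli_X * B'))"
      unfolding left using * by metis
    also have "\<dots> = s \<cdot>\<^sub>m ?K (Proj0 * A') B' + s \<cdot>\<^sub>m ?K (Proj1 * A') (Pauli_X * B')"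
      by (simp only: smult s(2,3))
    also have "\<dots> = s \<cdot>\<^sub>m (?K (Proj0 * A') B' + ?K (Proj1 * A') (Pauli_X * B'))"
      using c2 by (intro add_smult_distrib_left_mat [symmetric, of _ "2 ^ n" "2 ^ n"] K) auto
    finally show ?thesis by (simp only: right)
  next
    assume *: "A * Proj0 = a \<cdot>\<^sub>m (Proj1 * A') \<and> B = b \<cdot>\<^sub>m (Pauli_X * B')
       \<and> A * Proj1 = g \<cdot>\<^sub>m (Proj0 * A') \<and> B * Pauli_X = d \<cdot>\<^sub>m B'"
    have "Q * CNOT n c t
        = ?K (a \<cdot>\<^sub>m (Proj1 * A')) (b \<cdot>\<^sub>m (Pauli_X * B')) + ?K (g \<cdot>\<^sub>m (Proj0 * A')) (d \<cdot>\<^sub>m B')"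
      unfolding left using * by metis
    also have "\<dots> = s \<cdot>\<^sub>m ?K (Proj1 * A') (Pauli_X * B') + s \<cdot>\<^sub>m ?K (Proj0 * A') B'"
      by (simp only: smult s(2,3))
    also have "\<dots> = s \<cdot>\<^sub>m (?K (Proj1 * A') (Pauli_X * B') + ?K (Proj0 * A') B')"
      using c2 by (intro add_smult_distrib_left_mat [symmetric, of _ "2 ^ n" "2 ^ n"] K) auto
    \<comment> \<open>Here \<open>A\<close> exchanges the control projectors, so the summands appear
      in the opposite order.\<close>
    also have "?K (Proj1 * A') (Pauli_X * B') + ?K (Proj0 * A') B'
        = ?K (Proj0 * A') B' + ?K (Proj1 * A') (Pauli_X * B')"
      using c2 by (intro comm_add_mat [of _ "2 ^ n" "2 ^ n"] K) auto
    finally show ?thesis by (simp only: right)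
  qed
  with s(1) Rs show "\<exists>s\<in>{1, - 1}. \<exists>R\<in>pauli_ops n. Q * CNOT n c t = s \<cdot>\<^sub>m (CNOT n c t * R)"
    unfolding pauli_ops_eq by blast
qed

text \<open>Induction over the generated group: the identity is itself a Pauli, and the normalizing
  property passes to products and adjoints.\<close>

lemma clifford_normalizes_paulis:
  assumes "C \<in> clifford_group n"
  shows "normalizes_paulis n C"
proof -
  let ?R = "ring_mat TYPE(complex) (2 ^ n) ()"
  interpret ring ?R by (rule ring_mat)
  have gens: "normalizes_paulis n G" if "G \<in> clifford_gens n" for G
    using that normalizes_paulis_Hadamard normalizes_paulis_Phase_S normalizes_paulis_CNOT
    by (auto simp: clifford_gens_def)
  show ?thesis
    using assms unfolding clifford_group_def
  proof (induction rule: generate.induct)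
    case one
    have "normalizes_paulis n (kron_list (replicate n (1\<^sub>m 2)))"
      by (intro normalizes_paulis_pauli)
        (auto simp: pauli_ops_eq pauli_lists_def paulis1_def)
    then show ?case
      by (simp add: units_of_one ring_mat_simps kron_list_one)
  next
    case (incl h)
    then show ?case by (rule gens)
  next
    \<comment> \<open>Generators are unitary, so the inverse in the unit group is the
      adjoint.\<close>
    case (inv h)
    then have h: "normalizes_paulis n h" by (rule gens)
    then have "unitary_mat (2 ^ n) h" by (simp add: normalizes_paulis_def)
    note c = unitary_matD [OF this]
    then have "inv\<^bsub>?R\<^esub> h = mat_adjoint h"
      by (intro inv_unique' [symmetric]) (auto simp: ring_mat_simps)
    moreover have "h \<in> Units ?R"
      using c by (auto simp: Units_def ring_mat_simps)
    ultimately have "inv\<^bsub>units_of ?R\<^esub> h = mat_adjoint h"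
      by (simp add: units_of_inv)
    then show ?case using normalizes_paulis_adjoint [OF h] by simp
  next
    case (eng h1 h2)
    then show ?case
      by (simp add: units_of_mult ring_mat_simps normalizes_paulis_mult)
  qed
qed

section \<open>Pauli coefficients of Cliffords\<close>

text \<open>Parseval in bilinear form: expanding both traces in entries leaves a sum of products of
  two Pauli entries, which \<open>pauli_swap\<close> evaluates.\<close>

lemma pauli_tr_product_sum:
  assumes A: "A \<in> carrier_mat (2 ^ n) (2 ^ n)" and B: "B \<in> carrier_mat (2 ^ n) (2 ^ n)"
  shows "(\<Sum>Q\<in>pauli_ops n. mat_tr (A * Q) * mat_tr (B * Q)) = 2 ^ n * mat_tr (A * B)"
proof -
  let ?I = "{..<2 ^ n :: nat}"
  have tr: "mat_tr (X * Q) = (\<Sum>(i, j)\<in>?I \<times> ?I. X $$ (i, j) * Q $$ (j, i))"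
    if "X \<in> carrier_mat (2 ^ n) (2 ^ n)" "Q \<in> carrier_mat (2 ^ n) (2 ^ n)" for X Q :: "complex mat"
    using mat_tr_mult [OF that] by (simp add: sum.cartesian_product)
  have "(\<Sum>Q\<in>pauli_ops n. mat_tr (A * Q) * mat_tr (B * Q))
      = (\<Sum>Q\<in>pauli_ops n. \<Sum>p\<in>?I \<times> ?I. \<Sum>q\<in>?I \<times> ?I.
          A $$ p * B $$ q * (Q $$ (snd p, fst p) * Q $$ (snd q, fst q)))"
    using A B pauli_ops_carrier [of n]
    by (intro sum.cong) (auto simp: tr subset_iff sum_product case_prod_unfold mult_ac)
  also have "\<dots> = (\<Sum>p\<in>?I \<times> ?I. \<Sum>q\<in>?I \<times> ?I.
      A $$ p * B $$ q * (\<Sum>Q\<in>pauli_ops n. Q $$ (snd p, fst p) * Q $$ (snd q, fst q)))"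
    by (simp add: sum.swap [of _ _ "pauli_ops n"] sum_distrib_left)
  \<comment> \<open>The swap identity keeps only the pair \<open>q\<close> that is the transpose of
    \<open>p\<close>.\<close>
  also have "\<dots> = (\<Sum>p\<in>?I \<times> ?I. \<Sum>q\<in>?I \<times> ?I. if q = (snd p, fst p) then A $$ p * B $$ q * 2 ^ n else 0)"
    by (intro sum.cong) (auto simp: pauli_swap split: if_splits)
  also have "\<dots> = (\<Sum>p\<in>?I \<times> ?I. A $$ p * B $$ (snd p, fst p) * 2 ^ n)"
    by (intro sum.cong) (auto simp: sum.delta)
  also have "\<dots> = 2 ^ n * mat_tr (A * B)"
    unfolding tr [OF A B] by (simp add: sum_distrib_left case_prod_unfold mult_ac)
  finally show ?thesis .
qed

text \<open>This is the identity \<open>\<Sum> Q B Q = 2 ^ n (Tr B) I\<close> under a trace. It uses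
  the swap identity with the indices paired differently: now the index pairs of \<open>A\<close> and
  of \<open>B\<close> must both be diagonal, and two separate traces remain.\<close>

lemma pauli_twirl_tr:
  assumes A: "A \<in> carrier_mat (2 ^ n) (2 ^ n)" and B: "B \<in> carrier_mat (2 ^ n) (2 ^ n)"
  shows "(\<Sum>Q\<in>pauli_ops n. mat_tr (A * Q * B * Q)) = 2 ^ n * (mat_tr A * mat_tr B)"
proof -
  let ?I = "{..<2 ^ n :: nat}"
  have pairs: "(\<Sum>p\<in>?I \<times> ?I. f p) = (\<Sum>i\<in>?I. \<Sum>j\<in>?I. f (i, j))" for f :: "nat \<times> nat \<Rightarrow> complex"
    by (simp add: sum.cartesian_product)
  have tr: "mat_tr (A * Q * B * Q) = (\<Sum>p\<in>?I \<times> ?I. \<Sum>q\<in>?I \<times> ?I.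
      A $$ p * B $$ q * (Q $$ (snd p, fst q) * Q $$ (snd q, fst p)))"
    if Q: "Q \<in> carrier_mat (2 ^ n) (2 ^ n)" for Q :: "complex mat"
  proof -
    have "mat_tr (A * Q * B * Q) = mat_tr ((A * Q) * (B * Q))"
      using A B Q by (simp add: assoc_mult_mat [of _ "2 ^ n" "2 ^ n" _ "2 ^ n" _ "2 ^ n"]
          mult_carrier_mat [of _ "2 ^ n" "2 ^ n" _ "2 ^ n"])
    also have "\<dots> = (\<Sum>i\<in>?I. \<Sum>k\<in>?I. (A * Q) $$ (i, k) * (B * Q) $$ (k, i))"
      using A B Q by (intro mat_tr_mult) auto
    also have "\<dots> = (\<Sum>i\<in>?I. \<Sum>k\<in>?I. \<Sum>j\<in>?I. \<Sum>l\<in>?I.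
        A $$ (i, j) * B $$ (k, l) * (Q $$ (j, k) * Q $$ (l, i)))"
      using A B Q by (intro sum.cong)
        (auto simp: scalar_prod_def sum_product mult_ac simp flip: lessThan_atLeast0)
    \<comment> \<open>Exchanging the sums over \<open>j\<close> and \<open>k\<close> groups the
      indices into \<open>p = (i, j)\<close> for \<open>A\<close> and \<open>q = (k, l)\<close> for
      \<open>B\<close>.\<close>
    also have "\<dots> = (\<Sum>i\<in>?I. \<Sum>j\<in>?I. \<Sum>k\<in>?I. \<Sum>l\<in>?I.
        A $$ (i, j) * B $$ (k, l) * (Q $$ (j, k) * Q $$ (l, i)))"
      by (intro sum.cong refl sum.swap)
    finally show ?thesis by (simp only: pairs fst_conv snd_conv)
  qed
  have tr1: "mat_tr X = (\<Sum>p\<in>?I \<times> ?I. if fst p = snd p then X $$ p else 0)"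
    if "X \<in> carrier_mat (2 ^ n) (2 ^ n)" for X :: "complex mat"
    using that by (simp add: mat_tr_def pairs)
  have "(\<Sum>Q\<in>pauli_ops n. mat_tr (A * Q * B * Q))
      = (\<Sum>Q\<in>pauli_ops n. \<Sum>p\<in>?I \<times> ?I. \<Sum>q\<in>?I \<times> ?I.
          A $$ p * B $$ q * (Q $$ (snd p, fst q) * Q $$ (snd q, fst p)))"
    using pauli_ops_carrier [of n] by (intro sum.cong refl tr) auto
  also have "\<dots> = (\<Sum>p\<in>?I \<times> ?I. \<Sum>q\<in>?I \<times> ?I.
      A $$ p * B $$ q * (\<Sum>Q\<in>pauli_ops n. Q $$ (snd p, fst q) * Q $$ (snd q, fst p)))"
    by (simp add: sum.swap [of _ _ "pauli_ops n"] sum_distrib_left)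
  also have "\<dots> = (\<Sum>p\<in>?I \<times> ?I. \<Sum>q\<in>?I \<times> ?I. 2 ^ n *
      ((if fst p = snd p then A $$ p else 0) * (if fst q = snd q then B $$ q else 0)))"
    by (intro sum.cong) (auto simp: pauli_swap)
  also have "\<dots> = 2 ^ n * (mat_tr A * mat_tr B)"
    unfolding tr1 [OF A] tr1 [OF B] sum_product
    by (simp only: sum_distrib_left)
  finally show ?thesis .
qed

text \<open>The bilinear form is applied to \<open>U\<close> and its adjoint: as \<open>Q\<close> is
  Hermitian, the two traces are complex conjugates, and the product of the two matrices is the
  identity.\<close>

lemma unitary_parseval:
  assumes U: "unitary_mat (2 ^ n) U"
  shows "(\<Sum>Q\<in>pauli_ops n. (cmod (mat_tr (U * Q)))\<^sup>2) = (2 ^ n)\<^sup>2"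
proof -
  note c = unitary_matD [OF U]
  have "complex_of_real ((cmod (mat_tr (U * Q)))\<^sup>2) = mat_tr (U * Q) * mat_tr (mat_adjoint U * Q)"
    if Q: "Q \<in> pauli_ops n" for Q
  proof -
    note q = subsetD [OF pauli_ops_carrier Q]
    have "cnj (mat_tr (U * Q)) = mat_tr (mat_adjoint (U * Q))"
      using c q by (intro mat_tr_adjoint [of _ "2 ^ n", symmetric]) auto
    also have "mat_adjoint (U * Q) = Q * mat_adjoint U"
      using c q Q by (simp add: mat_adjoint_mult pauli_adjoint)
    also have "mat_tr (Q * mat_adjoint U) = mat_tr (mat_adjoint U * Q)"
      using c q by (intro mat_tr_comm) auto
    finally show ?thesis by (simp only: complex_norm_square)
  qed
  then have "complex_of_real (\<Sum>Q\<in>pauli_ops n. (cmod (mat_tr (U * Q)))\<^sup>2)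
      = (\<Sum>Q\<in>pauli_ops n. mat_tr (U * Q) * mat_tr (mat_adjoint U * Q))"
    unfolding of_real_sum by (intro sum.cong) auto
  also have "\<dots> = complex_of_real ((2 ^ n)\<^sup>2)"
    using c by (simp add: pauli_tr_product_sum mat_tr_one power2_eq_square)
  finally show ?thesis by (simp only: of_real_eq_iff)
qed

text \<open>Linearity of the trace, carried through \<open>finsum\<close>. The induction runs over
  arbitrary finite sets of square matrices, as subsets of the Paulis occur along the way.\<close>

lemma mat_tr_pauli_sum:
  assumes A: "A \<in> carrier_mat (2 ^ n) (2 ^ n)" and B: "B \<in> carrier_mat (2 ^ n) (2 ^ n)"
  shows "mat_tr (A * pauli_sum n r * B) = (\<Sum>P\<in>pauli_ops n. r P * mat_tr (A * P * B))"
proof -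
  let ?V = "module_mat TYPE(complex) (2 ^ n) (2 ^ n)"
  interpret abelian_group ?V by (rule abelian_group_mat)
  have "mat_tr (A * finsum ?V (\<lambda>P. r P \<cdot>\<^sub>m P) S * B) = (\<Sum>P\<in>S. r P * mat_tr (A * P * B))"
    if "finite S" "S \<subseteq> carrier_mat (2 ^ n) (2 ^ n)" for S
    using that
  proof (induction S rule: finite_induct)
    case empty
    then show ?case using A B by (simp add: module_mat_simps mat_tr_def)
  next
    case (insert P S)
    let ?F = "finsum ?V (\<lambda>P. r P \<cdot>\<^sub>m P) S"
    have F: "?F \<in> carrier_mat (2 ^ n) (2 ^ n)"
      using insert.prems finsum_closed [of "\<lambda>P. r P \<cdot>\<^sub>m P" S] by (auto simp: module_mat_simps Pi_def subset_iff)
    have P: "P \<in> carrier_mat (2 ^ n) (2 ^ n)" using insert.prems by simp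
    have "finsum ?V (\<lambda>P. r P \<cdot>\<^sub>m P) (insert P S) = r P \<cdot>\<^sub>m P + ?F"
      using insert.hyps insert.prems
      by (subst finsum_insert) (auto simp: module_mat_simps Pi_def subset_iff)
    also have "A * (r P \<cdot>\<^sub>m P + ?F) * B = r P \<cdot>\<^sub>m (A * P * B) + A * ?F * B"
      using A B P F by (simp add: mult_add_distrib_mat [of _ "2 ^ n" "2 ^ n" _ "2 ^ n"]
          add_mult_distrib_mat [of _ "2 ^ n" "2 ^ n" _ _ "2 ^ n"]
          mult_smult_distrib [of _ "2 ^ n" "2 ^ n" _ "2 ^ n"]
          mult_smult_assoc_mat [of _ "2 ^ n" "2 ^ n" _ "2 ^ n"]
          mult_carrier_mat [of _ "2 ^ n" "2 ^ n" _ "2 ^ n"])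
    also have "mat_tr \<dots> = r P * mat_tr (A * P * B) + mat_tr (A * ?F * B)"
      using A B P F by (simp add: mat_tr_add [of _ "2 ^ n"] mat_tr_smult [of _ "2 ^ n"]
          mult_carrier_mat [of _ "2 ^ n" "2 ^ n" _ "2 ^ n"])
    finally show ?case using insert by simp
  qed
  then show ?thesis
    unfolding pauli_sum_def using finite_pauli_ops pauli_ops_carrier by blast
qed

lemma mat_tr_pauli_coeff:
  assumes "P \<in> pauli_ops n"
  shows "mat_tr (pauli_sum n r * P) = 2 ^ n * r P"
proof -
  note p = subsetD [OF pauli_ops_carrier assms]
  have "mat_tr (pauli_sum n r * P) = (\<Sum>R\<in>pauli_ops n. r R * mat_tr (R * P))"
  proof -
    have one: "1\<^sub>m (2 ^ n) * R = R" if "R \<in> carrier_mat (2 ^ n) (2 ^ n)" for R :: "complex mat"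
      using that by simp
    have "pauli_sum n r \<in> carrier_mat (2 ^ n) (2 ^ n)"
    proof -
      interpret abelian_group "module_mat TYPE(complex) (2 ^ n) (2 ^ n)" by (rule abelian_group_mat)
      show ?thesis
        using finsum_closed [of "\<lambda>P. r P \<cdot>\<^sub>m P" "pauli_ops n"] pauli_ops_carrier [of n]
        by (auto simp: pauli_sum_def module_mat_simps Pi_def subset_iff)
    qed
    \<comment> \<open>The identity on the left brings the product into the three-factor form of
      \<open>mat_tr_pauli_sum\<close>.\<close>
    then have "mat_tr (pauli_sum n r * P) = mat_tr (1\<^sub>m (2 ^ n) * pauli_sum n r * P)"
      by simp
    also have "\<dots> = (\<Sum>R\<in>pauli_ops n. r R * mat_tr (1\<^sub>m (2 ^ n) * R * P))"
      by (rule mat_tr_pauli_sum [OF _ p]) simp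
    also have "\<dots> = (\<Sum>R\<in>pauli_ops n. r R * mat_tr (R * P))"
      using pauli_ops_carrier [of n] by (intro sum.cong) (auto simp: one subset_iff)
    finally show ?thesis .
  qed
  also have "\<dots> = (\<Sum>R\<in>pauli_ops n. if R = P then r R * 2 ^ n else 0)"
    using assms by (intro sum.cong) (auto simp: pauli_tr_mult)
  also have "\<dots> = 2 ^ n * r P"
    using assms by (simp add: finite_pauli_ops)
  finally show ?thesis .
qed

text \<open>For unitary \<open>U\<close> these are the Paulis that commute or anticommute with
  \<open>U\<close>. Allowing both signs makes the set insensitive to multiplying \<open>U\<close> by
  a Pauli.\<close>

definition fixed_paulis :: "nat \<Rightarrow> complex mat \<Rightarrow> complex mat set" where
  "fixed_paulis n U = {Q \<in> pauli_ops n. \<exists>s\<in>{1, - 1}. mat_adjoint U * Q * U = s \<cdot>\<^sub>m Q}"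

text \<open>The additional conjugation by \<open>P\<close> changes \<open>Q\<close> by at most a
  sign, since Paulis commute up to sign.\<close>

lemma fixed_paulis_subset:
  assumes U: "unitary_mat (2 ^ n) U" and P: "P \<in> pauli_ops n"
  shows "fixed_paulis n U \<subseteq> fixed_paulis n (U * P)"
proof
  fix Q assume "Q \<in> fixed_paulis n U"
  then obtain s where Q: "Q \<in> pauli_ops n" and s: "s \<in> {1, - 1}" "mat_adjoint U * Q * U = s \<cdot>\<^sub>m Q"
    unfolding fixed_paulis_def by blast
  obtain t where t: "t \<in> {1, - 1}" "P * Q = t \<cdot>\<^sub>m (Q * P)"
    using pauli_commute [OF P Q] by blast
  note c = unitary_matD [OF U] subsetD [OF pauli_ops_carrier P] subsetD [OF pauli_ops_carrier Q]
  note mat = assoc_mult_mat [of _ "2 ^ n" "2 ^ n" _ "2 ^ n" _ "2 ^ n"]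
    mult_carrier_mat [of _ "2 ^ n" "2 ^ n" _ "2 ^ n"]
  have "mat_adjoint (U * P) * Q * (U * P) = P * (mat_adjoint U * Q * U) * P"
    using c P by (simp add: mat_adjoint_mult pauli_adjoint mat)
  also have "\<dots> = s \<cdot>\<^sub>m (P * Q * P)"
    unfolding s(2) using c by (simp add: mult_smult_distrib [of _ "2 ^ n" "2 ^ n" _ "2 ^ n"]
          mult_smult_assoc_mat [of _ "2 ^ n" "2 ^ n" _ "2 ^ n"] mat)
  also have "P * Q * P = t \<cdot>\<^sub>m (Q * (P * P))"
    unfolding t(2) using c by (simp add: mult_smult_assoc_mat [of _ "2 ^ n" "2 ^ n" _ "2 ^ n"] mat)
  also have "s \<cdot>\<^sub>m \<dots> = (s * t) \<cdot>\<^sub>m Q"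
    using c P by (simp add: pauli_square smult_smult_mat)
  finally have "mat_adjoint (U * P) * Q * (U * P) = (s * t) \<cdot>\<^sub>m Q" .
  moreover have "s * t \<in> {1, - 1}" using s t by auto
  ultimately show "Q \<in> fixed_paulis n (U * P)"
    using Q unfolding fixed_paulis_def by blast
qed

lemma fixed_paulis_mult:
  assumes U: "unitary_mat (2 ^ n) U" and P: "P \<in> pauli_ops n"
  shows "fixed_paulis n (U * P) = fixed_paulis n U"
proof
  note c = unitary_matD [OF U] subsetD [OF pauli_ops_carrier P]
  \<comment> \<open>The reverse inclusion is the previous lemma for \<open>U * P\<close>, as
    multiplying by \<open>P\<close> once more restores \<open>U\<close>.\<close>
  have "U * P * P = U"
    using c P by (simp add: assoc_mult_mat [of _ "2 ^ n" "2 ^ n" _ "2 ^ n" _ "2 ^ n"] pauli_square)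
  then show "fixed_paulis n (U * P) \<subseteq> fixed_paulis n U"
    using fixed_paulis_subset [OF unitary_mat_mult [OF U pauli_unitary [OF P]] P] by simp
qed (rule fixed_paulis_subset [OF assms])

text \<open>A Pauli anticommuting with \<open>U\<close> would force the trace of \<open>U\<close> to vanish, so every Pauli fixed up
  to sign contributes \<open>+ 2 ^ n\<close> to the twirled trace.\<close>

lemma normalizes_paulis_tr:
  assumes U: "normalizes_paulis n U" and tr: "mat_tr U \<noteq> 0"
  shows "(cmod (mat_tr U))\<^sup>2 = card (fixed_paulis n U)"
proof -
  have u: "unitary_mat (2 ^ n) U" using U by (simp add: normalizes_paulis_def)
  note c = unitary_matD [OF u]
  note mat = assoc_mult_mat [of _ "2 ^ n" "2 ^ n" _ "2 ^ n" _ "2 ^ n"]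
    mult_carrier_mat [of _ "2 ^ n" "2 ^ n" _ "2 ^ n"]
  have not_minus: "mat_adjoint U * Q * U \<noteq> (- 1) \<cdot>\<^sub>m Q" if Q: "Q \<in> pauli_ops n" for Q
  proof
    assume *: "mat_adjoint U * Q * U = (- 1) \<cdot>\<^sub>m Q"
    note q = subsetD [OF pauli_ops_carrier Q]
    have "Q * U = U * (mat_adjoint U * Q * U)"
    proof -
      have "U * (mat_adjoint U * (Q * U)) = Q * U"
        using c q by (intro unitary_mat_cancel(2) [OF u, of _ "2 ^ n"]) auto
      moreover have "mat_adjoint U * Q * U = mat_adjoint U * (Q * U)"
        using c q by (intro assoc_mult_mat) auto
      ultimately show ?thesis by simp
    qed
    also have "\<dots> = (- 1) \<cdot>\<^sub>m (U * Q)"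
      unfolding * using c q by (intro mult_smult_distrib) auto
    finally have QU: "Q * U = (- 1) \<cdot>\<^sub>m (U * Q)" .
    \<comment> \<open>Insert \<open>Q * Q = 1\<close>, move one \<open>Q\<close> cyclically to the
      front and pass it back through \<open>U\<close>: the trace equals its own negative.\<close>
    have "mat_tr U = mat_tr (U * Q * Q)"
      using c q Q by (simp add: mat pauli_square)
    also have "\<dots> = mat_tr (Q * (U * Q))"
      using c q by (intro mat_tr_comm [of _ "2 ^ n" "2 ^ n"]) auto
    also have "Q * (U * Q) = (- 1) \<cdot>\<^sub>m (U * Q * Q)"
    proof -
      have "Q * (U * Q) = Q * U * Q"
        using c q by (intro assoc_mult_mat [symmetric]) auto
      also have "\<dots> = (- 1) \<cdot>\<^sub>m (U * Q * Q)"
        unfolding QU using c q by (intro mult_smult_assoc_mat) auto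
      finally show ?thesis .
    qed
    also have "\<dots> = (- 1) \<cdot>\<^sub>m U"
      using c q Q by (simp add: mat pauli_square)
    also have "mat_tr \<dots> = - mat_tr U"
      using mat_tr_smult [OF c(1), of "- 1"] by simp
    finally show False using tr by simp
  qed
  have summand: "mat_tr (mat_adjoint U * Q * U * Q) = (if Q \<in> fixed_paulis n U then 2 ^ n else 0)"
    if Q: "Q \<in> pauli_ops n" for Q
  proof -
    obtain s R where sR: "s \<in> {1, - 1}" "R \<in> pauli_ops n" "mat_adjoint U * Q * U = s \<cdot>\<^sub>m R"
    proof -
      have "mat_adjoint U * Q * U \<in> signed_paulis n"
        using U Q by (simp add: normalizes_paulis_def)
      then show thesis using that unfolding signed_paulis_def by blast
    qed
    note q = subsetD [OF pauli_ops_carrier Q] subsetD [OF pauli_ops_carrier sR(2)]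
    have val: "mat_tr (mat_adjoint U * Q * U * Q) = s * (if R = Q then 2 ^ n else 0)"
      unfolding sR(3) using q Q sR(2)
      by (simp add: mult_smult_assoc_mat [of _ "2 ^ n" "2 ^ n" _ "2 ^ n"]
          mat_tr_smult [of _ "2 ^ n"] mat(2) pauli_tr_mult)
    show ?thesis
    proof (cases "Q \<in> fixed_paulis n U")
      case True
      then have "mat_adjoint U * Q * U = Q"
        using not_minus [OF Q] by (auto simp: fixed_paulis_def)
      then show ?thesis using True Q by (simp add: pauli_tr_mult)
    next
      case False
      then have "R \<noteq> Q" using sR Q by (auto simp: fixed_paulis_def)
      then show ?thesis using False val by simp
    qed
  qed
  have "2 ^ n * complex_of_real ((cmod (mat_tr U))\<^sup>2) = 2 ^ n * (mat_tr (mat_adjoint U) * mat_tr U)"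
    using mat_tr_adjoint [OF c(1)] by (simp only: complex_norm_square mult.commute)
  also have "\<dots> = (\<Sum>Q\<in>pauli_ops n. mat_tr (mat_adjoint U * Q * U * Q))"
    using c by (intro pauli_twirl_tr [symmetric]) auto
  also have "\<dots> = (\<Sum>Q\<in>pauli_ops n. if Q \<in> fixed_paulis n U then 2 ^ n else 0)"
    by (intro sum.cong) (auto simp: summand)
  also have "\<dots> = 2 ^ n * complex_of_real (card (fixed_paulis n U))"
  proof -
    have "pauli_ops n \<inter> fixed_paulis n U = fixed_paulis n U" by (auto simp: fixed_paulis_def)
    then show ?thesis
      by (simp add: sum.If_cases finite_pauli_ops Collect_mem_eq)
  qed
  finally have "complex_of_real ((cmod (mat_tr U))\<^sup>2) = complex_of_real (card (fixed_paulis n U))"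
    by simp
  then show ?thesis by (simp only: of_real_eq_iff)
qed

text \<open>Each nonzero coefficient has the same scaled square \<open>K\<close>, because
  \<open>fixed_paulis_mult\<close> gives one count for all products \<open>C * P\<close>. Parseval
  then yields \<open>M * K = (2 ^ n)\<^sup>2\<close>, which determines the modulus.\<close>

lemma clifford_pauli_coeff:
  assumes C: "C \<in> clifford_group n" "C = pauli_sum n r"
    and M: "M = card {P \<in> pauli_ops n. r P \<noteq> 0}"
  shows "M > 0" "P \<in> pauli_ops n \<Longrightarrow> r P \<noteq> 0 \<Longrightarrow> cmod (r P) = 1 / sqrt M"
proof -
  have nC: "normalizes_paulis n C" by (rule clifford_normalizes_paulis [OF C(1)])
  then have uC: "unitary_mat (2 ^ n) C" by (simp add: normalizes_paulis_def)
  define K where "K = card (fixed_paulis n C)"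
  have coeff: "(2 ^ n * cmod (r P))\<^sup>2 = (if r P \<noteq> 0 then real K else 0)" if P: "P \<in> pauli_ops n" for P
  proof (cases "r P = 0")
    case False
    have tr: "mat_tr (C * P) = 2 ^ n * r P"
      unfolding C(2) by (rule mat_tr_pauli_coeff [OF P])
    then have "(cmod (mat_tr (C * P)))\<^sup>2 = card (fixed_paulis n (C * P))"
      using False by (intro normalizes_paulis_tr normalizes_paulis_mult nC normalizes_paulis_pauli P) auto
    then show ?thesis
      using False by (simp add: tr fixed_paulis_mult [OF uC P] K_def norm_mult norm_power)
  qed simp
  have "(2 ^ n)\<^sup>2 = (\<Sum>P\<in>pauli_ops n. (cmod (mat_tr (C * P)))\<^sup>2)"
    by (rule unitary_parseval [OF uC, symmetric])
  also have "\<dots> = (\<Sum>P\<in>pauli_ops n. if r P \<noteq> 0 then real K else 0)"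
    using coeff by (intro sum.cong) (auto simp: C(2) mat_tr_pauli_coeff norm_mult norm_power)
  also have "\<dots> = real M * real K"
    using finite_pauli_ops [of n] by (simp add: M sum.If_cases Int_def)
  finally have MK: "real M * real K = (2 ^ n)\<^sup>2" ..
  \<comment> \<open>The right-hand side of \<open>MK\<close> is nonzero, which excludes
    \<open>M = 0\<close>.\<close>
  then show M0: "M > 0" by (cases "M = 0") auto
  assume P: "P \<in> pauli_ops n" "r P \<noteq> 0"
  have "real M * (2 ^ n * cmod (r P))\<^sup>2 = (2 ^ n)\<^sup>2"
    using coeff [OF P(1)] P(2) MK by simp
  then have "(cmod (r P))\<^sup>2 = 1 / real M"
    using M0 by (simp add: power_mult_distrib field_simps)
  then have "cmod (r P) = sqrt (1 / real M)"
    by (metis norm_ge_zero real_sqrt_abs2 real_sqrt_unique)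
  then show "cmod (r P) = 1 / sqrt M" by (simp add: real_sqrt_divide)
qed

section \<open>Perturbation by a unitary close to the identity up to phase\<close>

text \<open>Both traces belong to the same unitary \<open>E * P\<close>, paired with
  \<open>P\<close> and with \<open>Q\<close>; Parseval bounds any two of its squared
  coefficients.\<close>

lemma unitary_tr_pair_bound:
  assumes E: "unitary_mat (2 ^ n) E" and P: "P \<in> pauli_ops n" and Q: "Q \<in> pauli_ops n" "P \<noteq> Q"
  shows "(cmod (mat_tr E))\<^sup>2 + (cmod (mat_tr (E * P * Q)))\<^sup>2 \<le> (2 ^ n)\<^sup>2"
proof -
  note c = unitary_matD [OF E] subsetD [OF pauli_ops_carrier P]
  have "E * P * P = E"
    using c P by (simp add: assoc_mult_mat [of _ "2 ^ n" "2 ^ n" _ "2 ^ n" _ "2 ^ n"] pauli_square)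
  then have "(cmod (mat_tr E))\<^sup>2 + (cmod (mat_tr (E * P * Q)))\<^sup>2
      = (\<Sum>R\<in>{P, Q}. (cmod (mat_tr (E * P * R)))\<^sup>2)"
    using Q(2) by simp
  also have "\<dots> \<le> (\<Sum>R\<in>pauli_ops n. (cmod (mat_tr (E * P * R)))\<^sup>2)"
    using P Q by (intro sum_mono2 finite_pauli_ops) auto
  also have "\<dots> = (2 ^ n)\<^sup>2"
    by (intro unitary_parseval unitary_mat_mult E pauli_unitary P)
  finally show ?thesis .
qed

theorem theorem3p1:
  fixes n N M :: nat and \<epsilon> :: real and E C\<^sub>0 P\<^sub>1 :: "complex mat" and r :: "complex mat \<Rightarrow> complex"
  assumes "n \<ge> 1" and "N = 2 ^ n"
    and "0 \<le> \<epsilon>" and "\<epsilon> \<le> 1"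
    and "unitary_mat N E"
    and "cmod (mat_tr E) \<ge> real N * (1 - \<epsilon>\<^sup>2)"
    and "C\<^sub>0 \<in> clifford_group n"
    and "C\<^sub>0 = pauli_sum n r"
    and "card {P \<in> pauli_ops n. r P \<noteq> 0} = M"
    and "P\<^sub>1 \<in> pauli_ops n"
  shows "(r P\<^sub>1 \<noteq> 0 \<longrightarrow>
            (1 - \<epsilon>\<^sup>2) / sqrt (real M) - sqrt (real M) * sqrt (2 * \<epsilon>\<^sup>2 - \<epsilon> ^ 4)
              \<le> cmod (mat_tr (E * C\<^sub>0 * P\<^sub>1) / of_nat N)
          \<and> cmod (mat_tr (E * C\<^sub>0 * P\<^sub>1) / of_nat N)
              \<le> 1 / sqrt (real M) + sqrt (real M) * sqrt (2 * \<epsilon>\<^sup>2 - \<epsilon> ^ 4))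
       \<and> (r P\<^sub>1 = 0 \<longrightarrow>
            0 \<le> cmod (mat_tr (E * C\<^sub>0 * P\<^sub>1) / of_nat N)
          \<and> cmod (mat_tr (E * C\<^sub>0 * P\<^sub>1) / of_nat N)
              \<le> sqrt (real M) * sqrt (2 * \<epsilon>\<^sup>2 - \<epsilon> ^ 4))"
proof -
  note P\<^sub>1 = \<open>P\<^sub>1 \<in> pauli_ops n\<close>
  have E: "unitary_mat (2 ^ n) E" using assms(2,5) by simp
  note c = unitary_matD [OF E] subsetD [OF pauli_ops_carrier P\<^sub>1]
  note coeff = clifford_pauli_coeff [OF assms(7,8) assms(9) [symmetric]]
  have N: "real N > 0" using assms(2) by simp
  define e where "e P = mat_tr (E * P * P\<^sub>1) / of_nat N" for P
  \<comment> \<open>The radicand is \<open>1 - (1 - \<epsilon>\<^sup>2)\<^sup>2\<close>, the squared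
    weight that Parseval leaves beside a coefficient of modulus at least
    \<open>1 - \<epsilon>\<^sup>2\<close>.\<close>
  define \<delta> where "\<delta> = sqrt (2 * \<epsilon>\<^sup>2 - \<epsilon> ^ 4)"
  define S where "S = {P \<in> pauli_ops n. r P \<noteq> 0}"
  have S: "finite S" "card S = M" using assms(9) finite_pauli_ops by (auto simp: S_def)
  \<comment> \<open>Here \<open>\<epsilon> \<le> 1\<close> enters: the lower bound on
    \<open>cmod (e P\<^sub>1)\<close> must be nonnegative to survive squaring.\<close>
  have \<epsilon>: "0 \<le> 1 - \<epsilon>\<^sup>2" using assms(3,4) by (simp add: abs_square_le_1)
  have \<delta>0: "0 \<le> \<delta>" unfolding \<delta>_def
    using \<epsilon> mult_nonneg_nonneg [of "\<epsilon>\<^sup>2" "2 - \<epsilon>\<^sup>2"] by (simp add: algebra_simps power2_eq_square power4_eq_xxxx)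
  have T: "mat_tr (E * C\<^sub>0 * P\<^sub>1) / of_nat N = (\<Sum>P\<in>pauli_ops n. r P * e P)"
    unfolding assms(8) mat_tr_pauli_sum [OF c(1) c(5)] e_def by (simp add: sum_divide_distrib)
  have eP1: "e P\<^sub>1 = mat_tr E / of_nat N"
    using c P\<^sub>1 by (simp add: e_def assoc_mult_mat [of _ "2 ^ n" "2 ^ n" _ "2 ^ n" _ "2 ^ n"] pauli_square)
  have e1: "1 - \<epsilon>\<^sup>2 \<le> cmod (e P\<^sub>1)"
    using assms(6) N by (simp add: eP1 norm_divide field_simps)
  have e_bound: "(cmod (e P\<^sub>1))\<^sup>2 + (cmod (e P))\<^sup>2 \<le> 1" if "P \<in> pauli_ops n" "P \<noteq> P\<^sub>1" for P
    using unitary_tr_pair_bound [OF E that(1) P\<^sub>1 that(2)] N assms(2)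
    unfolding eP1 by (simp add: e_def norm_divide power_divide divide_simps norm_power)
  have e_small: "cmod (e P) \<le> \<delta>" if "P \<in> pauli_ops n" "P \<noteq> P\<^sub>1" for P
  proof -
    have "(1 - \<epsilon>\<^sup>2)\<^sup>2 \<le> (cmod (e P\<^sub>1))\<^sup>2" using \<epsilon> e1 by (intro power_mono)
    with e_bound [OF that] have "(cmod (e P))\<^sup>2 \<le> 2 * \<epsilon>\<^sup>2 - \<epsilon> ^ 4"
      by (simp add: power2_eq_square power4_eq_xxxx algebra_simps)
    then show ?thesis unfolding \<delta>_def by (rule real_le_rsqrt)
  qed
  \<comment> \<open>At most \<open>M\<close> terms, each of modulus at most
    \<open>\<delta> / sqrt M\<close>, add up to at most \<open>sqrt M * \<delta>\<close>.\<close>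
  have rest: "cmod (\<Sum>P\<in>pauli_ops n - {P\<^sub>1}. r P * e P) \<le> sqrt M * \<delta>"
  proof -
    have "(\<Sum>P\<in>pauli_ops n - {P\<^sub>1}. r P * e P) = (\<Sum>P\<in>S - {P\<^sub>1}. r P * e P)"
      using finite_pauli_ops by (intro sum.mono_neutral_right) (auto simp: S_def)
    also have "cmod \<dots> \<le> (\<Sum>P\<in>S - {P\<^sub>1}. 1 / sqrt M * \<delta>)"
    proof (rule sum_norm_le)
      fix P assume "P \<in> S - {P\<^sub>1}"
      then show "cmod (r P * e P) \<le> 1 / sqrt M * \<delta>"
        using coeff(2) [of P] e_small [of P]
        by (auto simp: S_def norm_mult intro!: divide_right_mono)
    qed
    \<comment> \<open>Restoring the possibly missing index \<open>P\<^sub>1\<close> adds only a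
      nonnegative term and makes the number of terms exactly \<open>M\<close> in both cases.\<close>
    also have "\<dots> \<le> (\<Sum>P\<in>S. 1 / sqrt M * \<delta>)"
      using S \<delta>0 by (intro sum_mono2) auto
    also have "\<dots> = (real M / sqrt M) * \<delta>"
      using S by simp
    also have "\<dots> = sqrt M * \<delta>" by (simp add: real_div_sqrt)
    finally show ?thesis .
  qed
  have split: "mat_tr (E * C\<^sub>0 * P\<^sub>1) / of_nat N = r P\<^sub>1 * e P\<^sub>1 + (\<Sum>P\<in>pauli_ops n - {P\<^sub>1}. r P * e P)"
    unfolding T by (rule sum.remove [OF finite_pauli_ops P\<^sub>1])
  show ?thesis
  proof (cases "r P\<^sub>1 = 0")
    case True
    then show ?thesis using rest split by (simp add: \<delta>_def)
  next
    case False
    \<comment> \<open>Parseval for \<open>E * P\<^sub>1\<close> with only the coefficient at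
      \<open>P\<^sub>1\<close> kept.\<close>
    have e1': "cmod (e P\<^sub>1) \<le> 1"
    proof -
      have "(cmod (mat_tr (E * P\<^sub>1 * P\<^sub>1)))\<^sup>2 \<le> (2 ^ n)\<^sup>2"
        using member_le_sum [OF P\<^sub>1, of "\<lambda>Q. (cmod (mat_tr (E * P\<^sub>1 * Q)))\<^sup>2"] finite_pauli_ops
          unitary_parseval [OF unitary_mat_mult [OF E pauli_unitary [OF P\<^sub>1]]] by simp
      then have "cmod (mat_tr (E * P\<^sub>1 * P\<^sub>1)) \<le> 2 ^ n" by (rule power2_le_imp_le) simp
      then show ?thesis using assms(2) by (simp add: e_def norm_divide norm_power)
    qed
    have main: "cmod (r P\<^sub>1 * e P\<^sub>1) = cmod (e P\<^sub>1) / sqrt M"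
      using coeff(2) [OF P\<^sub>1 False] by (simp add: norm_mult)
    have "(1 - \<epsilon>\<^sup>2) / sqrt M \<le> cmod (r P\<^sub>1 * e P\<^sub>1)" "cmod (r P\<^sub>1 * e P\<^sub>1) \<le> 1 / sqrt M"
      unfolding main using e1 e1' by (auto intro!: divide_right_mono)
    \<comment> \<open>The two directions of the triangle inequality, with the term at
      \<open>P\<^sub>1\<close> as main part and \<open>rest\<close> as error.\<close>
    then have "(1 - \<epsilon>\<^sup>2) / sqrt M - sqrt M * \<delta> \<le> cmod (mat_tr (E * C\<^sub>0 * P\<^sub>1) / of_nat N)"
      "cmod (mat_tr (E * C\<^sub>0 * P\<^sub>1) / of_nat N) \<le> 1 / sqrt M + sqrt M * \<delta>"
      unfolding split
      using rest norm_triangle_ineq [of "r P\<^sub>1 * e P\<^sub>1" "\<Sum>P\<in>pauli_ops n - {P\<^sub>1}. r P * e P"]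
        norm_diff_ineq [of "r P\<^sub>1 * e P\<^sub>1" "\<Sum>P\<in>pauli_ops n - {P\<^sub>1}. r P * e P"] by linarith+
    then show ?thesis using False by (simp add: \<delta>_def)
  qed
qed

end
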